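(* There exists an integer $n_0$ such that for every $n\ge n_0$ divisible by $8$ there exist non-isomorphic graphs $G_n$ and $H_n$, each on $n$ vertices, such that $G_n\simeq_k H_n$ for every $k<\frac{1}{96}n-1$.
   Context: Graphs are finite, simple, undirected. For $k\ge1$, the $k$-dimensional Weisfeiler--Leman algorithm ($k$-WL) computes a stable coloring of $k$-tuples of vertices (for $k=1$: color refinement; for $k\ge2$: initial color of a tuple is the isomorphism type of the induced ordered subgraph, refined by the multiset over $w$ of the tuples of colors of the tuples obtained by replacing each single coordinate by $w$); colors are canonical across graphs. $G\simeq_k H$ means $k$-WL does not distinguish $G$ and $H$, i.e., the multisets of stable colors of all $k$-tuples of $G$ and of $H$ coincide. *)

theory Defs
  imports Complex_Main "HOL-Library.Multiset" "Graph_Theory.Graph_Theory"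
begin

text \<open>A finite simple undirected graph is a \<^locale>\<open>pair_graph\<close>: a finite, loop-free, symmetric
  digraph whose arcs are pairs of vertices. Isomorphism is \<^const>\<open>digraph_iso\<close>; for these graphs it
  is the usual notion:\<close>

lemma digraph_iso_pair_graph_iff:
  fixes G :: "'a pair_pre_digraph" and H :: "'b pair_pre_digraph"
  assumes "pair_graph G" and "pair_graph H"
  shows "digraph_iso (with_proj G) (with_proj H) \<longleftrightarrow>
    (\<exists>f. bij_betw f (pverts G) (pverts H) \<and>
      (\<forall>u\<in>pverts G. \<forall>v\<in>pverts G. (u, v) \<in> parcs G \<longleftrightarrow> (f u, f v) \<in> parcs H))"
    (is "?L \<longleftrightarrow> ?R")
proof
  interpret G: pair_graph G by fact
  interpret H: pair_graph H by fact
  assume ?L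
  then obtain h where h: "pre_digraph.digraph_isomorphism (with_proj G) h"
    and H: "with_proj H = app_iso h (with_proj G)"
    unfolding digraph_iso_def by blast
  let ?f = "iso_verts h"
  from H have V: "pverts H = ?f ` pverts G" and A: "parcs H = iso_arcs h ` parcs G"
    and T: "iso_tail h = fst" and D: "iso_head h = snd"
    by (simp_all add: with_proj_def app_iso_def)
  from h have inj: "inj_on ?f (pverts G)"
    and arcs: "\<And>a. a \<in> parcs G \<Longrightarrow> iso_arcs h a = (?f (fst a), ?f (snd a))"
    by (auto simp: pre_digraph.digraph_isomorphism_def T D prod_eq_iff)
  have "(u, v) \<in> parcs G \<longleftrightarrow> (?f u, ?f v) \<in> parcs H"
    if u: "u \<in> pverts G" and v: "v \<in> pverts G" for u v
  proof
    assume "(u, v) \<in> parcs G"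
    then show "(?f u, ?f v) \<in> parcs H" using arcs A by force
  next
    assume "(?f u, ?f v) \<in> parcs H"
    then obtain a where a: "a \<in> parcs G" "?f u = ?f (fst a)" "?f v = ?f (snd a)"
      using arcs A by auto
    then have "fst a \<in> pverts G" "snd a \<in> pverts G"
      using G.arc_fst_in_verts G.arc_snd_in_verts by auto
    with a inj u v have "a = (u, v)" by (metis inj_onD prod.collapse)
    with a show "(u, v) \<in> parcs G" by simp
  qed
  with inj V show ?R unfolding bij_betw_def by blast
next
  interpret G: pair_graph G by fact
  interpret H: pair_graph H by fact
  assume ?R
  then obtain f where f: "inj_on f (pverts G)" "f ` pverts G = pverts H"
    and e: "\<And>u v. u \<in> pverts G \<Longrightarrow> v \<in> pverts G \<Longrightarrow> (u, v) \<in> parcs G \<longleftrightarrow> (f u, f v) \<in> parcs H"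
    unfolding bij_betw_def by blast
  let ?h = "\<lparr>iso_verts = f, iso_arcs = map_prod f f, iso_head = snd, iso_tail = fst\<rparr>"
  have sub: "parcs G \<subseteq> pverts G \<times> pverts G"
    using G.in_arcsD1 G.in_arcsD2 by auto
  have "inj_on (map_prod f f) (pverts G \<times> pverts G)"
    using f(1) by (simp add: map_prod_inj_on)
  then have inj: "inj_on (map_prod f f) (parcs G)" using sub by (rule inj_on_subset)
  have arcs: "parcs H = map_prod f f ` parcs G"
  proof (rule set_eqI, rule iffI)
    fix a assume a: "a \<in> parcs H"
    then have "fst a \<in> f ` pverts G" "snd a \<in> f ` pverts G"
      using f(2) H.arc_fst_in_verts H.arc_snd_in_verts by auto
    then obtain u v where uv: "u \<in> pverts G" "v \<in> pverts G" "fst a = f u" "snd a = f v"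
      by blast
    then have a': "a = map_prod f f (u, v)" by (simp add: prod_eq_iff)
    with a uv e have "(u, v) \<in> parcs G" by simp
    then show "a \<in> map_prod f f ` parcs G" using a' by blast
  next
    fix a assume "a \<in> map_prod f f ` parcs G"
    then show "a \<in> parcs H" using e sub by auto
  qed
  have "pre_digraph.digraph_isomorphism (with_proj G) ?h"
    using f inj G.wf_digraph by (simp add: pre_digraph.digraph_isomorphism_def)
  moreover have "with_proj H = app_iso ?h (with_proj G)"
    using f arcs by (simp add: with_proj_def app_iso_def)
  ultimately show ?L unfolding digraph_iso_def by blast
qed

text \<open>Colors are terms recording how they arose, hence comparable across graphs.
  In \<open>Atomic E A\<close>, the relations \<open>E\<close> and \<open>A\<close> say which positions of the tuple carry
  equal and adjacent vertices; see \<open>atomic_type_eq_iff\<close> below.\<close>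

datatype wl_color =
    Atomic "nat rel" "nat rel"
  | Refined wl_color "wl_color list multiset"

definition wl_tuples :: "nat \<Rightarrow> 'a pair_pre_digraph \<Rightarrow> 'a list set" where
  "wl_tuples k G = {x. set x \<subseteq> pverts G \<and> length x = k}"

definition atomic_type :: "'a pair_pre_digraph \<Rightarrow> 'a list \<Rightarrow> wl_color" where
  "atomic_type G x = Atomic
     {(i, j). i < length x \<and> j < length x \<and> x ! i = x ! j}
     {(i, j). i < length x \<and> j < length x \<and> (x ! i, x ! j) \<in> parcs G}"

text \<open>For \<open>k = 1\<close> the initial coloring is constant because there are no loops, and the refinement
  ranges over the neighbors only, so this is color refinement.\<close>

primrec wl_round :: "nat \<Rightarrow> 'a pair_pre_digraph \<Rightarrow> nat \<Rightarrow> 'a list \<Rightarrow> wl_color" where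
  "wl_round k G 0 x = atomic_type G x"
| "wl_round k G (Suc r) x = Refined (wl_round k G r x)
     (if k = 1
      then {# [wl_round k G r [w]]. w \<in># mset_set {w \<in> pverts G. (hd x, w) \<in> parcs G} #}
      else {# map (\<lambda>i. wl_round k G r (x[i := w])) [0..<k]. w \<in># mset_set (pverts G) #})"

text \<open>The partition of the \<open>k\<close>-tuples can be properly refined fewer than \<open>n ^ k\<close> times, so it is
  stable after \<open>n ^ k\<close> rounds (\<open>wl_stable_color_stable\<close>). Stopping each graph at its first stable
  partition instead would be wrong: regular graphs of equal order but different degrees would get the same
  stable colors for \<open>k = 1\<close>. No later round separates more
  pairs of graphs (\<open>wl_equivalent_iff_all_rounds\<close>).\<close>

definition wl_stable_color :: "nat \<Rightarrow> 'a pair_pre_digraph \<Rightarrow> 'a list \<Rightarrow> wl_color" where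
  "wl_stable_color k G = wl_round k G (card (pverts G) ^ k)"

definition wl_equivalent :: "nat \<Rightarrow> 'a pair_pre_digraph \<Rightarrow> 'b pair_pre_digraph \<Rightarrow> bool" where
  "wl_equivalent k G H \<longleftrightarrow>
     image_mset (wl_stable_color k G) (mset_set (wl_tuples k G)) =
     image_mset (wl_stable_color k H) (mset_set (wl_tuples k H))"

lemma atomic_type_eq_iff:
  assumes "length x = length y"
  shows "atomic_type G x = atomic_type H y \<longleftrightarrow>
    (\<exists>f. bij_betw f (set x) (set y) \<and> map f x = y \<and>
      (\<forall>u\<in>set x. \<forall>v\<in>set x. (u, v) \<in> parcs G \<longleftrightarrow> (f u, f v) \<in> parcs H))"
    (is "?L \<longleftrightarrow> ?R")
proof
  assume ?L
  then have eq: "x ! i = x ! j \<longleftrightarrow> y ! i = y ! j"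
    and adj: "(x ! i, x ! j) \<in> parcs G \<longleftrightarrow> (y ! i, y ! j) \<in> parcs H"
    if "i < length x" "j < length x" for i j
    using that assms unfolding atomic_type_def by (auto simp: set_eq_iff)
  define f where "f u = y ! (SOME i. i < length x \<and> x ! i = u)" for u
  have f: "f (x ! i) = y ! i" if "i < length x" for i
  proof -
    have "\<exists>j. j < length x \<and> x ! j = x ! i" using that by blast
    from someI_ex[OF this] show ?thesis using eq that unfolding f_def by blast
  qed
  then have map: "map f x = y" using assms by (simp add: list_eq_iff_nth_eq)
  have "inj_on f (set x)"
    by (rule inj_onI) (metis eq f in_set_conv_nth)
  moreover have "f ` set x = set y" using map by (metis list.set_map)
  moreover have "(u, v) \<in> parcs G \<longleftrightarrow> (f u, f v) \<in> parcs H" if "u \<in> set x" "v \<in> set x" for u v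
    using that adj f by (metis in_set_conv_nth)
  ultimately show ?R using map unfolding bij_betw_def by blast
next
  assume ?R
  then obtain f where f: "inj_on f (set x)" "map f x = y"
    and "\<forall>u\<in>set x. \<forall>v\<in>set x. (u, v) \<in> parcs G \<longleftrightarrow> (f u, f v) \<in> parcs H"
    unfolding bij_betw_def by blast
  then show ?L
    unfolding atomic_type_def f(2)[symmetric]
    by (auto simp: inj_on_eq_iff)
qed

lemma finite_wl_tuples: "finite (pverts G) \<Longrightarrow> finite (wl_tuples k G)"
  unfolding wl_tuples_def by (rule finite_lists_length_eq)

lemma card_wl_tuples: "finite (pverts G) \<Longrightarrow> card (wl_tuples k G) = card (pverts G) ^ k"
  unfolding wl_tuples_def by (rule card_lists_length_eq)

primrec wl_previous :: "wl_color \<Rightarrow> wl_color" where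
  "wl_previous (Atomic E A) = Atomic E A"
| "wl_previous (Refined c M) = c"

primrec wl_lift :: "(wl_color \<Rightarrow> wl_color) \<Rightarrow> wl_color \<Rightarrow> wl_color" where
  "wl_lift h (Atomic E A) = Atomic E A"
| "wl_lift h (Refined c M) = Refined (Refined c M) (image_mset (map h) M)"

lemma wl_previous_round: "wl_previous (wl_round k G (Suc r) x) = wl_round k G r x"
  by simp

lemma wl_lift_round:
  assumes fin: "finite (pverts G)"
    and h: "\<And>x. x \<in> wl_tuples k G \<Longrightarrow> wl_round k G (Suc r) x = h (wl_round k G r x)"
    and x: "x \<in> wl_tuples k G"
  shows "wl_round k G (Suc (Suc r)) x = wl_lift h (wl_round k G (Suc r) x)"
proof -
  define M where "M s = (if k = 1
      then {# [wl_round k G s [w]]. w \<in># mset_set {w \<in> pverts G. (hd x, w) \<in> parcs G} #}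
      else {# map (\<lambda>i. wl_round k G s (x[i := w])) [0..<k]. w \<in># mset_set (pverts G) #})" for s
  have step: "wl_round k G (Suc s) x = Refined (wl_round k G s x) (M s)" for s
    by (simp add: M_def)
  have M: "M (Suc r) = image_mset (map h) (M r)"
  proof (cases "k = 1")
    case True
    have "wl_round k G (Suc r) [w] = h (wl_round k G r [w])" if "w \<in> pverts G" for w
      using that True by (intro h) (simp add: wl_tuples_def)
    then show ?thesis using True fin
      by (auto simp: M_def multiset.map_comp o_def simp del: wl_round.simps
          intro!: image_mset_cong)
  next
    case False
    have "wl_round k G (Suc r) (x[i := w]) = h (wl_round k G r (x[i := w]))"
      if "w \<in> pverts G" for i w
      using that x
      by (intro h) (auto simp: wl_tuples_def dest: set_update_subset_insert[THEN subsetD])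
    then show ?thesis using False fin
      by (auto simp: M_def multiset.map_comp o_def simp del: wl_round.simps
          intro!: image_mset_cong)
  qed
  have "wl_round k G (Suc (Suc r)) x =
      Refined (wl_round k G (Suc r) x) (image_mset (map h) (M r))"
    by (simp only: step[of "Suc r"] M)
  also have "\<dots> = wl_lift h (wl_round k G (Suc r) x)"
    by (simp only: step[of r] wl_lift.simps)
  finally show ?thesis .
qed

lemma wl_round_factor_mono:
  assumes fin: "finite (pverts G)"
    and h: "\<And>x. x \<in> wl_tuples k G \<Longrightarrow> wl_round k G (Suc r) x = h (wl_round k G r x)"
  shows "\<forall>x\<in>wl_tuples k G. wl_round k G (Suc (r + d)) x = (wl_lift ^^ d) h (wl_round k G (r + d) x)"
proof (induction d)
  case 0
  show ?case using h by simp
next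
  case (Suc d)
  then show ?case
    using wl_lift_round[OF fin, of k "r + d" "(wl_lift ^^ d) h"]
    by (simp del: wl_round.simps)
qed

lemma wl_round_stabilizes:
  assumes fin: "finite (pverts G)" and ne: "wl_tuples k G \<noteq> {}"
  obtains r h where "r < card (pverts G) ^ k"
    and "\<And>x. x \<in> wl_tuples k G \<Longrightarrow> wl_round k G (Suc r) x = h (wl_round k G r x)"
proof -
  let ?T = "wl_tuples k G" and ?N = "card (pverts G) ^ k"
  let ?a = "\<lambda>r. card (wl_round k G r ` ?T)"
  have finT: "finite ?T" using fin by (rule finite_wl_tuples)
  have img: "wl_round k G r ` ?T = wl_previous ` wl_round k G (Suc r) ` ?T" for r
    unfolding image_image wl_previous_round ..
  have "\<exists>r<?N. ?a (Suc r) \<le> ?a r"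
  proof (rule ccontr)
    assume "\<not> ?thesis"
    then have inc: "?a r < ?a (Suc r)" if "r < ?N" for r using that by (meson not_le)
    have "s < ?a s" if "s \<le> ?N" for s using that
    proof (induction s)
      case 0
      show ?case using finT ne by (simp add: card_gt_0_iff del: wl_round.simps)
    next
      case (Suc s)
      then show ?case using inc[of s] by linarith
    qed
    then have "?N < ?a ?N" by blast
    moreover have "?a ?N \<le> card ?T" using finT by (rule card_image_le)
    ultimately show False using card_wl_tuples[OF fin, of k] by linarith
  qed
  then obtain r where r: "r < ?N" "?a (Suc r) \<le> ?a r" by blast
  let ?B = "wl_round k G (Suc r) ` ?T"
  have finB: "finite ?B" using finT by blast
  have "card (wl_previous ` ?B) = card ?B"
    using r(2) card_image_le[OF finB, of wl_previous] unfolding img[of r] by (rule le_antisym[rotated])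
  then have inj: "inj_on wl_previous ?B" using finB by (rule eq_card_imp_inj_on[rotated])
  show ?thesis
  proof (rule that)
    show "r < ?N" by (fact r(1))
    fix x assume "x \<in> ?T"
    then show "wl_round k G (Suc r) x = inv_into ?B wl_previous (wl_round k G r x)"
      using inv_into_f_f[OF inj, of "wl_round k G (Suc r) x"] wl_previous_round[of k G r x]
      by (simp del: wl_round.simps)
  qed
qed

lemma wl_round_factor:
  assumes fin: "finite (pverts G)" and r: "card (pverts G) ^ k \<le> Suc r"
  obtains h where "\<And>x. x \<in> wl_tuples k G \<Longrightarrow> wl_round k G (Suc r) x = h (wl_round k G r x)"
proof (cases "wl_tuples k G = {}")
  case True
  then show ?thesis using that by blast
next
  case False
  from wl_round_stabilizes[OF fin False] obtain s h
    where s: "s < card (pverts G) ^ k"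
      and h: "\<And>x. x \<in> wl_tuples k G \<Longrightarrow> wl_round k G (Suc s) x = h (wl_round k G s x)"
    by blast
  have "s + (r - s) = r" using s r by simp
  then show ?thesis using that wl_round_factor_mono[OF fin h, of "r - s"] by metis
qed

lemma wl_stable_color_stable:
  assumes fin: "finite (pverts G)"
    and x: "x \<in> wl_tuples k G" and y: "y \<in> wl_tuples k G"
    and r: "card (pverts G) ^ k \<le> r"
  shows "wl_round k G r x = wl_round k G r y \<longleftrightarrow>
    wl_stable_color k G x = wl_stable_color k G y"
  using r
proof (induction r rule: dec_induct)
  case base
  show ?case by (simp add: wl_stable_color_def)
next
  case (step s)
  from step.hyps obtain h
    where "\<And>x. x \<in> wl_tuples k G \<Longrightarrow> wl_round k G (Suc s) x = h (wl_round k G s x)"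
    using wl_round_factor[OF fin, of k s] by (metis le_SucI)
  then have "wl_round k G (Suc s) x = wl_round k G (Suc s) y \<longleftrightarrow>
      wl_round k G s x = wl_round k G s y"
    using x y by (metis wl_previous_round)
  then show ?case using step.IH by blast
qed

lemma wl_equivalent_iff_all_rounds:
  fixes G :: "'a pair_pre_digraph" and H :: "'b pair_pre_digraph"
  assumes finG: "finite (pverts G)" and finH: "finite (pverts H)"
  shows "wl_equivalent k G H \<longleftrightarrow>
    (\<forall>r. image_mset (wl_round k G r) (mset_set (wl_tuples k G)) =
         image_mset (wl_round k H r) (mset_set (wl_tuples k H)))"
    (is "_ \<longleftrightarrow> (\<forall>r. ?mG r = ?mH r)")
proof -
  let ?TG = "wl_tuples k G" and ?TH = "wl_tuples k H"
  let ?N = "card (pverts G) ^ k"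
  have finT: "finite ?TG" "finite ?TH" using finG finH by (simp_all add: finite_wl_tuples)
  have N: "card (pverts H) ^ k = ?N" if "image_mset f (mset_set ?TG) = image_mset g (mset_set ?TH)"
    for f :: "'a list \<Rightarrow> wl_color" and g :: "'b list \<Rightarrow> wl_color"
    using arg_cong[OF that, of size] by (simp add: card_wl_tuples finG finH)
  have equiv: "wl_equivalent k G H \<longleftrightarrow> card (pverts H) ^ k = ?N \<and> ?mG ?N = ?mH ?N"
    unfolding wl_equivalent_def wl_stable_color_def using N by metis
  have "?mG r = ?mH r" if NH: "card (pverts H) ^ k = ?N" and eq: "?mG ?N = ?mH ?N" for r
  proof (cases "r \<le> ?N")
    case True
    then show ?thesis
    proof (induction r rule: inc_induct)
      case base
      show ?case by (fact eq)
    next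
      case (step s)
      from arg_cong[OF step.IH, of "image_mset wl_previous"]
      show ?case by (simp add: multiset.map_comp o_def)
    qed
  next
    case False
    show ?thesis
    proof (cases "?N = 0")
      case True
      then have "card ?TG = 0" "card ?TH = 0"
        using NH card_wl_tuples[OF finG, of k] card_wl_tuples[OF finH, of k] by presburger+
      then have "?TG = {}" "?TH = {}" using finT by simp_all
      then show ?thesis by simp
    next
      case NZ: False
      then obtain M where M: "?N = Suc M" using not0_implies_Suc by blast
      obtain f where f: "\<And>x. x \<in> ?TG \<Longrightarrow> wl_round k G (Suc M) x = f (wl_round k G M x)"
        using wl_round_factor[OF finG, of k M] M by auto
      obtain g where g: "\<And>x. x \<in> ?TH \<Longrightarrow> wl_round k H (Suc M) x = g (wl_round k H M x)"
        using wl_round_factor[OF finH, of k M] M NH by auto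
      have "wl_round k G (Suc M) ` ?TG = wl_round k H (Suc M) ` ?TH"
        using arg_cong[OF eq, of set_mset] finT M by (simp del: wl_round.simps)
      have f': "wl_round k H (Suc M) y = f (wl_round k H M y)" if "y \<in> ?TH" for y
      proof -
        from that have "wl_round k H (Suc M) y \<in> wl_round k G (Suc M) ` ?TG"
          unfolding \<open>wl_round k G (Suc M) ` ?TG = _\<close> by blast
        then obtain x where x: "x \<in> ?TG" "wl_round k G (Suc M) x = wl_round k H (Suc M) y"
          by force
        then have "wl_round k G M x = wl_round k H M y" by (metis wl_previous_round)
        with x f[OF x(1)] show ?thesis by (simp del: wl_round.simps)
      qed
      have *: "?mG (Suc (M + d)) = ?mH (Suc (M + d))" for d
      proof (induction d)
        case 0
        show ?case using eq M by (simp del: wl_round.simps)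
      next
        case (Suc d)
        let ?h = "(wl_lift ^^ Suc d) f"
        have "?mG (Suc (M + Suc d)) = image_mset ?h (?mG (M + Suc d))"
          using wl_round_factor_mono[OF finG f, of "Suc d"] finT
          by (auto simp: multiset.map_comp o_def simp del: wl_round.simps intro!: image_mset_cong)
        also have "\<dots> = image_mset ?h (?mH (M + Suc d))" using Suc by (simp del: wl_round.simps)
        also have "\<dots> = ?mH (Suc (M + Suc d))"
          using wl_round_factor_mono[OF finH f', of "Suc d"] finT
          by (auto simp: multiset.map_comp o_def simp del: wl_round.simps intro!: image_mset_cong)
        finally show ?case .
      qed
      show ?thesis using *[of "r - Suc M"] False M by simp
    qed
  qed
  moreover have "card (pverts H) ^ k = ?N" if "\<forall>r. ?mG r = ?mH r" using N that by blast
  ultimately show ?thesis unfolding equiv by blast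
qed

end

theory Submission
  imports Defs "HOL-Library.FuncSet" "HOL-Library.Nat_Bijection"
begin

text \<open>Let \<open>u = \<lfloor>n / 96\<rfloor>\<close>. The base graph is a path on \<open>24 u\<close> vertices together with a perfect matching,
  and \<open>G\<close>, \<open>H\<close> are its untwisted and once twisted Cai--Fuerer--Immerman graphs without edge gadgets, padded
  with isolated vertices; a gadget has at most 4 vertices, so \<open>n\<close> vertices suffice.

  For a random matching, deleting any \<open>u\<close> vertices leaves a component with more than \<open>17 u\<close> vertices.
  Otherwise some union \<open>A\<close> of components has between \<open>6 u\<close> and \<open>23 u / 2\<close> vertices. There are at most
  \<open>2 ^ (u + 1)\<close> such \<open>A\<close> closed under the path for each of the \<open>(24 u choose u)\<close> deleted sets, while no
  matching edge leaves \<open>A\<close> into the rest with probability at most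
  \<open>(6/23 \<cdot> 4/21 \<cdot> 2/19) ^ u\<close>, so a union bound applies. As the large components are more than half of the graph, they
  form a haven, and Duplicator wins the bijective game by keeping the twist in the large component that
  remains when the pebbled gadgets are deleted.

  \<open>G\<close> and \<open>H\<close> are not isomorphic since the base graph has more homomorphisms to \<open>G\<close> than to \<open>H\<close>.\<close>

section \<open>Random matchings\<close>

text \<open>The offsets \<open>e = u - 1 - 2 * j\<close> are symmetric about 0, so pairing
  \<open>j\<close> with \<open>u - 1 - j\<close> turns the square of each product into a product of
  terms \<open>x^2 - e^2\<close>; and \<open>(x^2 - e^2) / x^2\<close> increases with
  \<open>x\<close>.\<close>

lemma centered_prod_le:
  fixes c d :: real and u :: nat
  assumes "real u \<le> c" "c \<le> d"
  shows "(\<Prod>j<u. c + (real u - 1 - 2 * real j)) * d ^ u \<le> (\<Prod>j<u. d + (real u - 1 - 2 * real j)) * c ^ u"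
proof (rule power2_le_imp_le)
  let ?e = "\<lambda>j. real u - 1 - 2 * real j"
  have e: "\<bar>?e j\<bar> \<le> real u" if "j < u" for j using that by auto
  have sq: "(\<Prod>j<u. x + ?e j)\<^sup>2 = (\<Prod>j<u. x\<^sup>2 - (?e j)\<^sup>2)" for x :: real
  proof -
    have "(\<Prod>j<u. x + ?e j) = (\<Prod>j<u. x + ?e (u - Suc j))"
      by (rule prod.nat_diff_reindex[symmetric])
    also have "\<dots> = (\<Prod>j<u. x - ?e j)"
      by (intro prod.cong) (auto simp: of_nat_diff algebra_simps)
    finally have "(\<Prod>j<u. x + ?e j)\<^sup>2 = (\<Prod>j<u. x + ?e j) * (\<Prod>j<u. x - ?e j)"
      by (simp add: power2_eq_square)
    then show ?thesis
      by (simp add: prod.distrib[symmetric] square_diff_square_factored power2_eq_square)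
  qed
  have "(\<Prod>j<u. c\<^sup>2 - (?e j)\<^sup>2) * (\<Prod>j<u. d\<^sup>2) \<le> (\<Prod>j<u. d\<^sup>2 - (?e j)\<^sup>2) * (\<Prod>j<u. c\<^sup>2)"
    unfolding prod.distrib[symmetric]
  proof (intro prod_mono conjI)
    fix j assume "j \<in> {..<u}"
    then have "\<bar>?e j\<bar> \<le> \<bar>c\<bar>" using e[of j] assms by auto
    then have "(?e j)\<^sup>2 \<le> c\<^sup>2" using abs_le_square_iff by blast
    then show "0 \<le> (c\<^sup>2 - (?e j)\<^sup>2) * d\<^sup>2" by simp
    have "c\<^sup>2 \<le> d\<^sup>2" using assms by (intro power_mono) auto
    then have "(?e j)\<^sup>2 * c\<^sup>2 \<le> (?e j)\<^sup>2 * d\<^sup>2" by (intro mult_left_mono) auto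
    then show "(c\<^sup>2 - (?e j)\<^sup>2) * d\<^sup>2 \<le> (d\<^sup>2 - (?e j)\<^sup>2) * c\<^sup>2"
      by (simp add: algebra_simps)
  qed
  then show "((\<Prod>j<u. c + ?e j) * d ^ u)\<^sup>2 \<le> ((\<Prod>j<u. d + ?e j) * c ^ u)\<^sup>2"
    unfolding power_mult_distrib sq by (simp flip: power_mult add: mult.commute)
  have "0 \<le> d + ?e j" if "j < u" for j using e[OF that] assms by auto
  then show "0 \<le> (\<Prod>j<u. d + ?e j) * c ^ u"
    using assms by (intro mult_nonneg_nonneg prod_nonneg) auto
qed

lemma prod_lessThan_add:
  fixes f :: "nat \<Rightarrow> 'a :: comm_monoid_mult"
  shows "(\<Prod>j<m + n. f j) = (\<Prod>j<m. f j) * (\<Prod>j<n. f (m + j))"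
  by (induction n) (simp_all add: mult_ac)

text \<open>Both products split into three blocks of \<open>u\<close> factors, centred at
  \<open>6 * u\<close>, \<open>4 * u\<close>, \<open>2 * u\<close> on the left and at
  \<open>23 * u\<close>, \<open>21 * u\<close>, \<open>19 * u\<close> on the right. The bases
  \<open>48\<close> and \<open>9177\<close> are the products of these coefficients.\<close>

lemma block_prod_le:
  fixes u :: nat
  assumes "u > 0"
  shows "(\<Prod>j<3 * u. 7 * real u - 1 - 2 * real j) * 9177 ^ u
    \<le> (\<Prod>j<3 * u. 24 * real u - 1 - 2 * real j) * 48 ^ u"
proof -
  let ?P = "\<lambda>c. \<Prod>j<u. c * real u + (real u - 1 - 2 * real j)"
  have split: "(\<Prod>j<3 * u. (c + 5) * real u + (real u - 1 - 2 * real j)) = ?P (c + 5) * ?P (c + 3) * ?P (c + 1)" for c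
  proof -
    have "3 * u = u + u + u" by simp
    then show ?thesis
      by (simp only: prod_lessThan_add) (simp add: algebra_simps)
  qed
  have P: "?P c * d ^ u \<le> ?P d * c ^ u" if "1 \<le> c" "c \<le> d" for c d
  proof -
    have "?P c * (d * real u) ^ u \<le> ?P d * (c * real u) ^ u"
      using that assms by (intro centered_prod_le) (auto simp: mult_right_mono)
    then show ?thesis using assms by (simp add: power_mult_distrib)
  qed
  have P0: "0 \<le> ?P c" if "1 \<le> c" for c
  proof (rule prod_nonneg)
    fix j assume "j \<in> {..<u}"
    then have "real j + 1 \<le> real u" by auto
    moreover have "1 * real u \<le> c * real u" using that by (intro mult_right_mono) auto
    ultimately show "0 \<le> c * real u + (real u - 1 - 2 * real j)" by linarith
  qed
  have "(?P 6 * 23 ^ u) * (?P 4 * 21 ^ u) * (?P 2 * 19 ^ u) \<le> (?P 23 * 6 ^ u) * (?P 21 * 4 ^ u) * (?P 19 * 2 ^ u)"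
    by (rule mult_mono[OF mult_mono[OF P P] P]) (intro mult_nonneg_nonneg P0 zero_le_power | simp)+
  moreover have "(9177::real) = 23 * 21 * 19" "(48::real) = 6 * 4 * 2" by simp_all
  ultimately have "(?P 6 * ?P 4 * ?P 2) * 9177 ^ u \<le> (?P 23 * ?P 21 * ?P 19) * 48 ^ u"
    by (simp only: power_mult_distrib mult_ac)
  with split[of 1] split[of 18] show ?thesis by (simp add: algebra_simps)
qed

text \<open>This is the term \<open>k = u\<close> of the expansion of
  \<open>(1 + 23) ^ (24 * u)\<close>; the weight 23 makes it the largest one.\<close>

lemma binomial_24_le: "real ((24 * u) choose u) * (23 ^ 23) ^ u \<le> (24 ^ 24) ^ u"
proof -
  have "((24 * u) choose u) * 23 ^ (24 * u - u) \<le> (\<Sum>k\<le>24 * u. ((24 * u) choose k) * 23 ^ (24 * u - k) :: nat)"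
    by (rule member_le_sum) auto
  also have "\<dots> = 24 ^ (24 * u)" using binomial[of 1 23 "24 * u"] by simp
  finally have "real (((24 * u) choose u) * 23 ^ (23 * u)) \<le> real (24 ^ (24 * u))"
    by (simp only: of_nat_le_iff) (simp add: mult.commute)
  then show ?thesis by (simp add: power_mult)
qed

lemma union_bound_estimate:
  fixes u :: nat
  assumes "u \<ge> 2"
  shows "real (((24 * u) choose u) * 2 ^ (u + 1)) * (\<Prod>j<3 * u. 7 * real u - 1 - 2 * real j)
    < (\<Prod>j<3 * u. 24 * real u - 1 - 2 * real j)"
proof -
  let ?a = "\<Prod>j<3 * u. 7 * real u - 1 - 2 * real j"
  let ?b = "\<Prod>j<3 * u. 24 * real u - 1 - 2 * real j"
  let ?B = "real ((24 * u) choose u)"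
  have a: "0 \<le> ?a" by (rule prod_nonneg) auto
  have b: "0 < ?b" by (rule prod_pos) auto
  have "(?B * 2 ^ (u + 1) * ?a) * (23 ^ 23 * 9177) ^ u = 2 * 2 ^ u * ((?B * (23 ^ 23) ^ u) * (?a * 9177 ^ u))"
    by (simp only: power_mult_distrib power_add power_one_right mult_ac)
  also have "\<dots> \<le> 2 * 2 ^ u * ((24 ^ 24) ^ u * (?b * 48 ^ u))"
    using assms a b by (intro mult_left_mono mult_mono binomial_24_le block_prod_le) auto
  also have "\<dots> = 2 * (24 ^ 24 * 96) ^ u * ?b"
    by (simp only: power_mult_distrib[symmetric] mult_ac) (simp add: mult_ac power_mult_distrib[symmetric])
  also have "\<dots> < (23 ^ 23 * 9177) ^ u * ?b"
  proof (intro mult_strict_right_mono b)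
    \<comment> \<open>The ratio of the two bases is about 0.67. Rounding it up to
      \<open>7/10\<close> is harmless because \<open>2 * (7/10)^2 < 1\<close>, hence
      \<open>u \<ge> 2\<close>.\<close>
    have "2 * (24 ^ 24 * 96 :: real) ^ u \<le> 2 * (7/10 * (23 ^ 23 * 9177)) ^ u"
      by (intro mult_left_mono power_mono) auto
    also have "\<dots> = 2 * (7/10) ^ u * (23 ^ 23 * 9177) ^ u" by (simp only: power_mult_distrib mult_ac)
    also have "\<dots> < 1 * (23 ^ 23 * 9177) ^ u"
    proof (intro mult_strict_right_mono)
      have "(7/10 :: real) ^ u \<le> (7/10) ^ 2" using assms by (intro power_decreasing) auto
      also have "\<dots> < 1 / 2" by (simp add: power2_eq_square)
      finally show "2 * (7/10 :: real) ^ u < 1" by simp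
    qed simp
    finally show "2 * (24 ^ 24 * 96 :: real) ^ u < (23 ^ 23 * 9177) ^ u" by simp
  qed
  finally have "(?B * 2 ^ (u + 1) * ?a) * (23 ^ 23 * 9177) ^ u < ?b * (23 ^ 23 * 9177) ^ u"
    by (simp only: mult.commute)
  then have "?B * 2 ^ (u + 1) * ?a < ?b"
    by (rule mult_right_less_imp_less) simp
  then show ?thesis by simp
qed

section \<open>Counting perfect matchings\<close>

definition perfect_matchings :: "'a set \<Rightarrow> 'a set set set" where
  "perfect_matchings V = {M. \<Union>M = V \<and> (\<forall>e\<in>M. card e = 2) \<and> (\<forall>e\<in>M. \<forall>f\<in>M. e \<inter> f \<noteq> {} \<longrightarrow> e = f)}"

lemma finite_perfect_matchings: "finite V \<Longrightarrow> finite (perfect_matchings V)"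
  by (rule finite_subset[of _ "Pow (Pow V)"]) (auto simp: perfect_matchings_def)

lemma perfect_matchings_empty: "perfect_matchings {} = {{}}"
proof (rule set_eqI)
  fix M :: "'a set set"
  have "M = {}" if "\<Union>M = {}" "\<forall>e\<in>M. card e = 2"
  proof (rule ccontr)
    assume "M \<noteq> {}"
    then obtain e where "e \<in> M" by blast
    with that have "e = {}" "card e = 2" by auto
    then show False by simp
  qed
  then show "M \<in> perfect_matchings {} \<longleftrightarrow> M \<in> {{}}" by (auto simp: perfect_matchings_def)
qed

lemma perfect_matchings_insert:
  assumes M: "M \<in> perfect_matchings (V - {v, w})" and "v \<in> V" "w \<in> V - {v}"
  shows "insert {v, w} M \<in> perfect_matchings V"
proof -
  have "card {v, w} = 2" using assms by auto
  moreover have "e \<inter> {v, w} = {}" if "e \<in> M" for e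
    using M that by (auto simp: perfect_matchings_def)
  ultimately show ?thesis
    using assms by (fastforce simp: perfect_matchings_def)
qed

lemma perfect_matchings_cases:
  assumes M: "M \<in> perfect_matchings V" and v: "v \<in> V"
  obtains w M' where "w \<in> V - {v}" "M' \<in> perfect_matchings (V - {v, w})" "M = insert {v, w} M'"
proof -
  from M v obtain e where e: "e \<in> M" "v \<in> e" by (auto simp: perfect_matchings_def)
  with M have "card e = 2" by (auto simp: perfect_matchings_def)
  then obtain x y where "e = {x, y}" "x \<noteq> y" by (auto simp: card_2_iff)
  with e obtain w where w: "e = {v, w}" "w \<noteq> v" by fastforce
  have wV: "w \<in> V" using M e w by (auto simp: perfect_matchings_def)
  have dis: "f \<inter> {v, w} = {}" if "f \<in> M - {e}" for f
    using M e that unfolding w(1)[symmetric] by (auto simp: perfect_matchings_def)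
  have "\<Union>(M - {e}) = V - {v, w}"
  proof
    show "\<Union>(M - {e}) \<subseteq> V - {v, w}" using dis M by (auto simp: perfect_matchings_def)
    show "V - {v, w} \<subseteq> \<Union>(M - {e})"
    proof
      fix z assume z: "z \<in> V - {v, w}"
      then obtain f where "f \<in> M" "z \<in> f" using M by (auto simp: perfect_matchings_def)
      moreover from this z have "f \<noteq> e" using w by auto
      ultimately show "z \<in> \<Union>(M - {e})" by blast
    qed
  qed
  then have "M - {e} \<in> perfect_matchings (V - {v, w})"
    using M unfolding perfect_matchings_def by blast
  moreover have "M = insert {v, w} (M - {e})" using e w by auto
  ultimately show ?thesis using that w wV by blast
qed

text \<open>The double factorial \<open>(n - 1)!!\<close> for even \<open>n\<close>, and 0 for odd
  \<open>n\<close>.\<close>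

fun matching_number :: "nat \<Rightarrow> nat" where
  "matching_number 0 = 1"
| "matching_number (Suc 0) = 0"
| "matching_number (Suc (Suc n)) = Suc n * matching_number n"

lemma matching_number_even_pos: "matching_number (2 * n) > 0"
  by (induction n) auto

lemma matching_number_rec: "n > 0 \<Longrightarrow> matching_number n = (n - 1) * matching_number (n - 2)"
  by (cases n rule: matching_number.cases) auto

lemma matching_number_prod:
  "2 * l \<le> n \<Longrightarrow> matching_number n = (\<Prod>j<l. n - 1 - 2 * j) * matching_number (n - 2 * l)"
proof (induction l)
  case (Suc l)
  then have "matching_number (n - 2 * l) = (n - 1 - 2 * l) * matching_number (n - 2 * Suc l)"
    using matching_number_rec[of "n - 2 * l"] by (simp add: diff_diff_left add.commute)
  with Suc show ?case by (simp add: mult_ac)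
qed simp

text \<open>The partner \<open>w\<close> of a fixed vertex \<open>v\<close> sorts the matchings into
  \<open>card V - 1\<close> classes, each in bijection with the matchings of
  \<open>V - {v, w}\<close>.\<close>

lemma card_perfect_matchings:
  fixes V :: "'a set"
  assumes "finite V"
  shows "card (perfect_matchings V) = matching_number (card V)"
  using assms
proof (induction "card V" arbitrary: V rule: less_induct)
  case less
  show ?case
  proof (cases "V = {}")
    case True
    then show ?thesis by (simp add: perfect_matchings_empty)
  next
    case False
    then obtain v where v: "v \<in> V" by blast
    let ?X = "\<lambda>w. insert {v, w} ` perfect_matchings (V - {v, w})"
    have notin: "{v, w} \<notin> M" if "M \<in> perfect_matchings (V - {v, w'})" for w w' :: 'a and M
      using that by (auto simp: perfect_matchings_def)
    have card_X: "card (?X w) = matching_number (card V - 2)" if "w \<in> V - {v}" for w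
    proof -
      have c: "card (V - {v, w}) = card V - 2" using that v less.prems by (subst card_Diff_subset) auto
      moreover have "card V > 0" using v less.prems card_gt_0_iff by blast
      ultimately have "card (perfect_matchings (V - {v, w})) = matching_number (card V - 2)"
        using less.hyps[of "V - {v, w}"] less.prems by auto
      moreover have "inj_on (insert {v, w}) (perfect_matchings (V - {v, w}))"
        using notin by (intro inj_onI) (metis insert_ident)
      ultimately show ?thesis by (simp add: card_image)
    qed
    have "perfect_matchings V = (\<Union>w\<in>V - {v}. ?X w)"
      using perfect_matchings_insert[OF _ v] by (auto elim!: perfect_matchings_cases[OF _ v])
    also have "card \<dots> = (\<Sum>w\<in>V - {v}. card (?X w))"
    proof (rule card_UN_disjoint)
      show "\<forall>w\<in>V - {v}. \<forall>w'\<in>V - {v}. w \<noteq> w' \<longrightarrow> ?X w \<inter> ?X w' = {}"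
      proof (intro ballI impI)
        fix w w' :: 'a assume ne: "w \<noteq> w'"
        show "?X w \<inter> ?X w' = {}"
        proof (rule ccontr)
          assume "?X w \<inter> ?X w' \<noteq> {}"
          then obtain M M' where M: "M \<in> perfect_matchings (V - {v, w})"
            and eq: "insert {v, w} M = insert {v, w'} M'" by blast
          from eq have "{v, w'} \<in> insert {v, w} M" by simp
          with notin[OF M, of w'] have "{v, w'} = {v, w}" by simp
          with ne show False by (auto simp: doubleton_eq_iff)
        qed
      qed
    qed (use less.prems in \<open>auto simp: finite_perfect_matchings\<close>)
    also have "\<dots> = (card V - 1) * matching_number (card V - 2)"
      using card_X v less.prems by simp
    also have "\<dots> = matching_number (card V)"
      using matching_number_rec[of "card V"] False less.prems by (simp add: card_gt_0_iff)
    finally show ?thesis .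
  qed
qed

section \<open>Matchings with no edge between two sets\<close>

definition separating_matchings :: "'a set \<Rightarrow> 'a set \<Rightarrow> 'a set \<Rightarrow> 'a set set set" where
  "separating_matchings V A C = {M \<in> perfect_matchings V. \<forall>e\<in>M. e \<inter> A = {} \<or> e \<inter> C = {}}"

text \<open>Factor \<open>j\<close> counts the partners open to a vertex inside a set of
  \<open>x\<close> vertices after \<open>j\<close> pairs have left it; the remaining vertices are
  matched arbitrarily.\<close>

definition separating_bound :: "nat \<Rightarrow> nat \<Rightarrow> nat \<Rightarrow> nat" where
  "separating_bound l x n = (\<Prod>j<l. x - 1 - 2 * j) * matching_number (n - 2 * l)"

lemma separating_bound_Suc:
  "separating_bound (Suc l) x n = (x - 1) * separating_bound l (x - 2) (n - 2)"
proof -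
  have "x - 1 - 2 * Suc j = x - 2 - 1 - 2 * j" "n - 2 * Suc l = n - 2 - 2 * l" for j by simp_all
  then show ?thesis
    by (simp only: separating_bound_def prod.lessThan_Suc_shift mult.assoc) simp
qed

text \<open>The partners of \<open>l\<close> vertices of \<open>A\<close> are revealed one after the other; each of them has to lie
  in \<open>V - C\<close>, which loses two vertices in every step.\<close>

lemma card_separating_matchings_le:
  assumes "finite V" "C \<subseteq> V" "A \<subseteq> V - C" "2 * l \<le> card A + 1"
  shows "card (separating_matchings V A C) \<le> separating_bound l (card (V - C)) (card V)"
  using assms
proof (induction l arbitrary: V A)
  case 0
  have "card (separating_matchings V A C) \<le> card (perfect_matchings V)"
    using 0 by (intro card_mono finite_perfect_matchings) (auto simp: separating_matchings_def)
  then show ?case using 0 by (simp add: separating_bound_def card_perfect_matchings)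
next
  case (Suc l)
  have finA: "finite A" using Suc.prems finite_subset by blast
  from Suc.prems have "card A > 0" by simp
  then obtain v where v: "v \<in> A" by fastforce
  let ?B = "V - C"
  let ?X = "\<lambda>w. insert {v, w} ` separating_matchings (V - {v, w}) (A - {v, w}) C"
  have sub: "separating_matchings V A C \<subseteq> (\<Union>w\<in>?B - {v}. ?X w)"
  proof
    fix M assume M: "M \<in> separating_matchings V A C"
    then have "M \<in> perfect_matchings V" "v \<in> V" using v Suc.prems by (auto simp: separating_matchings_def)
    then obtain w M' where w: "w \<in> V - {v}" and M': "M' \<in> perfect_matchings (V - {v, w})"
      and eq: "M = insert {v, w} M'" by (rule perfect_matchings_cases)
    have "w \<notin> C" using M v unfolding eq separating_matchings_def by auto
    moreover have "M' \<in> separating_matchings (V - {v, w}) (A - {v, w}) C"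
      using M M' unfolding eq separating_matchings_def by auto
    ultimately show "M \<in> (\<Union>w\<in>?B - {v}. ?X w)" using w eq by blast
  qed
  have X: "card (?X w) \<le> separating_bound l (card ?B - 2) (card V - 2)" if w: "w \<in> ?B - {v}" for w
  proof -
    have fin: "finite (separating_matchings (V - {v, w}) (A - {v, w}) C)"
      using Suc.prems finite_perfect_matchings[of "V - {v, w}"] by (auto simp: separating_matchings_def)
    have "card (?X w) \<le> card (separating_matchings (V - {v, w}) (A - {v, w}) C)"
      by (rule card_image_le[OF fin])
    also have "\<dots> \<le> separating_bound l (card (V - {v, w} - C)) (card (V - {v, w}))"
    proof (rule Suc.IH)
      \<comment> \<open>The partner \<open>w\<close> may lie in \<open>A\<close> as well, so
        \<open>A\<close> can lose two vertices per step; the \<open>+ 1\<close> admits a last single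
        vertex.\<close>
      have "card A - card {v, w} \<le> card (A - {v, w})"
        by (rule diff_card_le_card_Diff) simp
      moreover have "card {v, w} = 2" using w by auto
      ultimately show "2 * l \<le> card (A - {v, w}) + 1" using Suc.prems(4) by simp
    qed (use Suc.prems v w in auto)
    also have "card (V - {v, w}) = card V - 2"
      using Suc.prems v w by (subst card_Diff_subset) auto
    also have "V - {v, w} - C = ?B - {v, w}" by auto
    also have "card \<dots> = card ?B - 2"
      using Suc.prems v w by (subst card_Diff_subset) auto
    finally show ?thesis .
  qed
  have "card (separating_matchings V A C) \<le> card (\<Union>w\<in>?B - {v}. ?X w)"
    using Suc.prems(1)
    by (intro card_mono sub) (auto simp: separating_matchings_def finite_perfect_matchings)
  also have "\<dots> \<le> (\<Sum>w\<in>?B - {v}. card (?X w))"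
    using Suc.prems by (intro card_UN_le) auto
  also have "\<dots> \<le> (\<Sum>w\<in>?B - {v}. separating_bound l (card ?B - 2) (card V - 2))"
    by (intro sum_mono X)
  also have "\<dots> = (card ?B - 1) * separating_bound l (card ?B - 2) (card V - 2)"
    using v Suc.prems by (subst sum_constant, subst card_Diff_singleton) auto
  finally show ?case by (simp add: separating_bound_Suc)
qed

lemma separating_bound_mono: "x \<le> y \<Longrightarrow> separating_bound l x n \<le> separating_bound l y n"
  unfolding separating_bound_def by (intro mult_right_mono prod_mono) auto

text \<open>The factor \<open>n - 2 * l - 1\<close> of \<open>matching_number (n - 2 * l)\<close> is
  traded for \<open>x + 1\<close>, which is no larger.\<close>

lemma separating_bound_step:
  assumes "x + 2 + 2 * l \<le> n"
  shows "separating_bound (Suc l) (x + 2) n \<le> separating_bound l x n"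
proof -
  have "separating_bound (Suc l) (x + 2) n = (\<Prod>j<l. x - 1 - 2 * j) * ((x + 1) * matching_number (n - 2 * Suc l))"
    by (simp add: separating_bound_def prod.lessThan_Suc_shift algebra_simps del: prod.lessThan_Suc)
  also have "\<dots> \<le> (\<Prod>j<l. x - 1 - 2 * j) * ((n - 2 * l - 1) * matching_number (n - 2 * Suc l))"
    using assms by (intro mult_left_mono mult_right_mono) auto
  also have "(n - 2 * l - 1) * matching_number (n - 2 * Suc l) = matching_number (n - 2 * l)"
    using matching_number_rec[of "n - 2 * l"] assms by (simp add: diff_diff_left add.commute)
  finally show ?thesis by (simp add: separating_bound_def)
qed

text \<open>With \<open>l\<close> half of \<open>card A\<close> rounded up, the bound does not
  increase as \<open>A\<close> grows, so the worst case is \<open>card A = 6 * u\<close>. The upper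
  limit on \<open>card A\<close> secures the hypothesis of
  \<open>separating_bound_step\<close>.\<close>

lemma card_balanced_separating_matchings_le:
  fixes u :: nat
  assumes "finite V" "C \<subseteq> V" "A \<subseteq> V - C" "card V = 24 * u" "card (V - C) = card A + u"
    and a: "6 * u \<le> card A" "2 * card A \<le> 23 * u"
  shows "card (separating_matchings V A C) \<le> separating_bound (3 * u) (7 * u) (24 * u)"
proof -
  define l where "l = (card A + 1) div 2"
  have "card (separating_matchings V A C) \<le> separating_bound l (card A + u) (24 * u)"
    using card_separating_matchings_le[OF assms(1-3), of l] assms by (simp add: l_def)
  also have "\<dots> \<le> separating_bound l (2 * l + u) (24 * u)"
    by (intro separating_bound_mono) (auto simp: l_def)
  also have "\<dots> \<le> separating_bound (3 * u) (7 * u) (24 * u)"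
  proof -
    have "3 * u \<le> l" "4 * l \<le> 2 * card A + 2" using a by (auto simp: l_def)
    then show ?thesis
    proof (induction l rule: dec_induct)
      case (step l)
      have "separating_bound (Suc l) (2 * Suc l + u) (24 * u) \<le> separating_bound l (2 * l + u) (24 * u)"
        using separating_bound_step[of "2 * l + u" l "24 * u"] step.prems a by (simp add: add_ac)
      with step show ?case by simp
    qed simp
  qed
  finally show ?thesis .
qed

lemma separating_bound_small:
  fixes u :: nat
  assumes "u \<ge> 2"
  shows "((24 * u) choose u) * 2 ^ (u + 1) * separating_bound (3 * u) (7 * u) (24 * u) < matching_number (24 * u)"
proof -
  let ?m = "matching_number (24 * u - 2 * (3 * u))"
  have m: "?m > 0" using matching_number_even_pos[of "9 * u"] by simp
  have P: "real (\<Prod>j<3 * u. x * u - 1 - 2 * j) = (\<Prod>j<3 * u. real x * real u - 1 - 2 * real j)" if "x \<ge> 7" for x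
    unfolding of_nat_prod
  proof (rule prod.cong)
    fix j assume "j \<in> {..<3 * u}"
    \<comment> \<open>So the truncated subtraction agrees with the real one.\<close>
    then have "1 + 2 * j \<le> 7 * u" by auto
    also have "\<dots> \<le> x * u" using that by simp
    finally show "real (x * u - 1 - 2 * j) = real x * real u - 1 - 2 * real j" by (simp add: of_nat_diff)
  qed simp
  have "real (((24 * u) choose u) * 2 ^ (u + 1) * (\<Prod>j<3 * u. 7 * u - 1 - 2 * j)) < real (\<Prod>j<3 * u. 24 * u - 1 - 2 * j)"
    using union_bound_estimate[OF assms] P[of 7] P[of 24] by simp
  then have "((24 * u) choose u) * 2 ^ (u + 1) * (\<Prod>j<3 * u. 7 * u - 1 - 2 * j) < (\<Prod>j<3 * u. 24 * u - 1 - 2 * j)"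
    by (simp only: of_nat_less_iff)
  then have "((24 * u) choose u) * 2 ^ (u + 1) * (\<Prod>j<3 * u. 7 * u - 1 - 2 * j) * ?m < (\<Prod>j<3 * u. 24 * u - 1 - 2 * j) * ?m"
    using m by (rule mult_strict_right_mono)
  then show ?thesis
    using matching_number_prod[of "3 * u" "24 * u"] by (simp add: separating_bound_def mult_ac)
qed

section \<open>Union bound over the separations of the path\<close>

text \<open>Closure is demanded along path edges only, so the family is fixed before the matching is
  drawn.\<close>

definition path_separations :: "nat \<Rightarrow> (nat set \<times> nat set) set" where
  "path_separations u = {(S, A). S \<subseteq> {..<24 * u} \<and> card S = u \<and> A \<subseteq> {..<24 * u} - S \<and>
     (\<forall>i. i \<notin> S \<and> Suc i \<in> {..<24 * u} - S \<longrightarrow> (i \<in> A \<longleftrightarrow> Suc i \<in> A)) \<and>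
     6 * u \<le> card A \<and> 2 * card A \<le> 23 * u}"

text \<open>The set \<open>A\<close> is a union of segments of the path with \<open>S\<close> removed, and every segment
  starts at \<open>0\<close> or at the successor of an element of \<open>S\<close>.\<close>

lemma card_path_separations_le:
  "card (path_separations u) \<le> ((24 * u) choose u) * 2 ^ (u + 1)"
proof -
  let ?V = "{..<24 * u}"
  let ?T = "\<lambda>S. insert 0 (Suc ` S)"
  let ?I = "{S. S \<subseteq> ?V \<and> card S = u}"
  have finS: "finite S" if "S \<in> ?I" for S using that finite_subset by blast
  have "inj_on (\<lambda>(S, A). (S, A \<inter> ?T S)) (path_separations u)"
  proof (rule inj_onI)
    fix p q
    assume "p \<in> path_separations u" "q \<in> path_separations u"
      "(\<lambda>(S, A). (S, A \<inter> ?T S)) p = (\<lambda>(S, A). (S, A \<inter> ?T S)) q"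
    then obtain S A A' where pq: "p = (S, A)" "q = (S, A')"
      and A: "(S, A) \<in> path_separations u" "(S, A') \<in> path_separations u"
      and eq: "A \<inter> ?T S = A' \<inter> ?T S"
      by (cases p, cases q) auto
    have "i \<in> A \<longleftrightarrow> i \<in> A'" for i
    proof (induction i)
      case 0
      show ?case using eq by auto
    next
      case (Suc i)
      show ?case
      proof (cases "i \<in> S")
        case True
        then show ?thesis using eq by auto
      next
        case False
        then show ?thesis using A Suc unfolding path_separations_def by (auto 4 4)
      qed
    qed
    then have "A = A'" by blast
    then show "p = q" by (simp add: pq)
  qed
  then have "card (path_separations u) = card ((\<lambda>(S, A). (S, A \<inter> ?T S)) ` path_separations u)"
    by (simp add: card_image)
  also have "\<dots> \<le> card (Sigma ?I (\<lambda>S. Pow (?T S)))"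
    using finS by (intro card_mono finite_SigmaI) (auto simp: path_separations_def)
  also have "\<dots> = (\<Sum>S\<in>?I. 2 ^ card (?T S))"
    using finS by (subst card_SigmaI) (auto simp: card_Pow)
  also have "\<dots> \<le> (\<Sum>S\<in>?I. 2 ^ (u + 1))"
  proof (intro sum_mono power_increasing)
    fix S assume S: "S \<in> ?I"
    have "card (?T S) \<le> Suc (card (Suc ` S))" by (rule card_insert_le_m1) auto
    also have "\<dots> \<le> u + 1" using S card_image_le[OF finS[OF S], of Suc] by simp
    finally show "card (?T S) \<le> u + 1" .
  qed simp
  also have "\<dots> = ((24 * u) choose u) * 2 ^ (u + 1)"
    using n_subsets[of ?V u] by simp
  finally show ?thesis .
qed

lemma expanding_matching_exists:
  assumes "u \<ge> 2"
  obtains M where "M \<in> perfect_matchings {..<24 * u}"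
    and "\<And>S A. (S, A) \<in> path_separations u \<Longrightarrow> M \<notin> separating_matchings {..<24 * u} A ({..<24 * u} - S - A)"
proof -
  let ?V = "{..<24 * u}"
  let ?X = "\<lambda>(S, A). separating_matchings ?V A (?V - S - A)"
  have fin: "finite (path_separations u)"
    by (rule finite_subset[of _ "Pow ?V \<times> Pow ?V"]) (auto simp: path_separations_def)
  have "card (\<Union>p\<in>path_separations u. ?X p) \<le> (\<Sum>p\<in>path_separations u. card (?X p))"
    by (rule card_UN_le[OF fin])
  also have "\<dots> \<le> (\<Sum>p\<in>path_separations u. separating_bound (3 * u) (7 * u) (24 * u))"
  proof (intro sum_mono, clarify)
    fix S A assume "(S, A) \<in> path_separations u"
    then have SA: "S \<subseteq> ?V" "card S = u" "A \<subseteq> ?V - S" "6 * u \<le> card A" "2 * card A \<le> 23 * u"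
      by (auto simp: path_separations_def)
    have "?V - (?V - S - A) = A \<union> S" using SA by auto
    moreover have "finite A" "finite S" using SA finite_subset[of _ ?V] by blast+
    then have "card (A \<union> S) = card A + u"
      using SA by (subst card_Un_disjoint) auto
    ultimately show "card (separating_matchings ?V A (?V - S - A)) \<le> separating_bound (3 * u) (7 * u) (24 * u)"
      using SA by (intro card_balanced_separating_matchings_le) auto
  qed
  also have "\<dots> = card (path_separations u) * separating_bound (3 * u) (7 * u) (24 * u)" by simp
  also have "\<dots> \<le> ((24 * u) choose u) * 2 ^ (u + 1) * separating_bound (3 * u) (7 * u) (24 * u)"
    by (intro mult_right_mono card_path_separations_le) simp
  also have "\<dots> < matching_number (24 * u)" by (rule separating_bound_small[OF assms])
  also have "\<dots> = card (perfect_matchings ?V)" by (simp add: card_perfect_matchings)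
  finally have "card (\<Union>p\<in>path_separations u. ?X p) < card (perfect_matchings ?V)" .
  moreover have "finite (\<Union>p\<in>path_separations u. ?X p)"
    using fin by (auto simp: separating_matchings_def finite_perfect_matchings)
  ultimately have "\<not> perfect_matchings ?V \<subseteq> (\<Union>p\<in>path_separations u. ?X p)"
    using card_mono by (meson not_le)
  then show ?thesis using that by fastforce
qed

text \<open>If \<open>6 * u \<le> card A \<le> 17 * u\<close>, then \<open>A\<close> or the rest of
  the complement of \<open>S\<close> has between \<open>6 * u\<close> and \<open>23 * u / 2\<close>
  vertices, as together they have \<open>23 * u\<close>. That side is closed along the path and no
  matching edge joins it to the other one, contrary to the choice of the matching.\<close>

lemma expanding_graph_exists:
  assumes "u \<ge> 2"
  obtains E :: "nat rel" where "E \<subseteq> {..<24 * u} \<times> {..<24 * u}" "sym E" "irrefl E"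
    "\<And>v. card (E `` {v}) \<le> 3"
    "\<And>S A. S \<subseteq> {..<24 * u} \<Longrightarrow> card S = u \<Longrightarrow> A \<subseteq> {..<24 * u} - S \<Longrightarrow>
       E `` A \<subseteq> A \<union> S \<Longrightarrow> card A < 6 * u \<or> 17 * u < card A"
proof -
  let ?V = "{..<24 * u}"
  from expanding_matching_exists[OF assms] obtain M where M: "M \<in> perfect_matchings ?V"
    and exp: "\<And>S A. (S, A) \<in> path_separations u \<Longrightarrow> M \<notin> separating_matchings ?V A (?V - S - A)"
    by blast
  define E where "E = {(i, j). i \<in> ?V \<and> j \<in> ?V \<and> (j = Suc i \<or> i = Suc j \<or> {i, j} \<in> M)}"
  have EV: "E \<subseteq> ?V \<times> ?V" by (auto simp: E_def)
  have symE: "sym E" by (auto simp: sym_def E_def insert_commute)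
  have "irrefl E"
  proof (rule irreflI)
    fix i :: nat
    have "card {i, i} \<noteq> 2" by simp
    then have "{i, i} \<notin> M" using M unfolding perfect_matchings_def by blast
    then show "(i, i) \<notin> E" by (auto simp: E_def)
  qed
  moreover have "card (E `` {v}) \<le> 3" for v
  proof -
    define W where "W = {w. {v, w} \<in> M}"
    have "w = w'" if "w \<in> W" "w' \<in> W" for w w'
    proof -
      from M have "\<forall>e\<in>M. \<forall>f\<in>M. e \<inter> f \<noteq> {} \<longrightarrow> e = f" by (simp add: perfect_matchings_def)
      moreover have "{v, w} \<in> M" "{v, w'} \<in> M" using that by (auto simp: W_def)
      ultimately have "{v, w} = {v, w'}" by (metis Int_iff empty_iff insertI1)
      then show ?thesis by (auto simp: doubleton_eq_iff)
    qed
    then have "\<exists>z. W \<subseteq> {z}" by (cases "W = {}") blast+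
    then obtain z where z: "W \<subseteq> {z}" by blast
    \<comment> \<open>Two path neighbours and at most one partner; at \<open>v = 0\<close> the entry
      \<open>v - 1\<close> is 0, which does no harm in a superset.\<close>
    have "E `` {v} \<subseteq> {Suc v, v - 1, z}" using z by (auto simp: E_def W_def)
    then have "card (E `` {v}) \<le> card {Suc v, v - 1, z}" by (intro card_mono) auto
    also have "\<dots> \<le> 3" by (simp add: card_insert_if)
    finally show ?thesis .
  qed
  moreover have "card A < 6 * u \<or> 17 * u < card A"
    if S: "S \<subseteq> ?V" "card S = u" and A: "A \<subseteq> ?V - S" and closed: "E `` A \<subseteq> A \<union> S" for S A
  proof (rule ccontr)
    assume neg: "\<not> ?thesis"
    let ?B = "?V - S - A"
    have finA: "finite A" "finite S" using A S finite_subset by blast+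
    have "card (?V - S) = 23 * u" using S finA by (simp add: card_Diff_subset)
    then have cards: "card ?B = 23 * u - card A" using A finA by (simp add: card_Diff_subset)
    have no: "(x, y) \<notin> E" "(y, x) \<notin> E" if "x \<in> A" "y \<in> ?B" for x y
      using that closed symE unfolding sym_def by blast+
    have step: "(i, Suc i) \<in> E" if "Suc i \<in> ?V" for i using that by (auto simp: E_def)
    have path: "i \<in> A \<longleftrightarrow> Suc i \<in> A" if "i \<notin> S" "Suc i \<in> ?V - S" for i
      using no[of i "Suc i"] no[of "Suc i" i] step[of i] that by auto
    have sep: "M \<in> separating_matchings ?V A ?B" "M \<in> separating_matchings ?V ?B A"
    proof -
      have "e \<inter> A = {} \<or> e \<inter> ?B = {}" if e: "e \<in> M" for e
      proof (rule ccontr)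
        assume "\<not> ?thesis"
        then obtain x y where xy: "x \<in> e" "x \<in> A" "y \<in> e" "y \<in> ?B" by blast
        have "card e = 2" using e M by (auto simp: perfect_matchings_def)
        then obtain p q where pq: "e = {p, q}" by (auto simp: card_2_iff)
        have "e = {x, y}" using xy unfolding pq by auto
        then have "(x, y) \<in> E" using e xy A by (auto simp: E_def)
        then show False using no(1)[OF xy(2,4)] by blast
      qed
      then show "M \<in> separating_matchings ?V A ?B" "M \<in> separating_matchings ?V ?B A"
        using M unfolding separating_matchings_def by blast+
    qed
    show False
    proof (cases "2 * card A \<le> 23 * u")
      case True
      then have "(S, A) \<in> path_separations u"
        using S A path neg unfolding path_separations_def by auto
      with exp sep show False by blast
    next
      case False
      then have "(S, ?B) \<in> path_separations u"
        using S A path neg cards unfolding path_separations_def by auto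
      moreover have "?V - S - ?B = A" using A by auto
      ultimately show False using exp[of S ?B] sep by simp
    qed
  qed
  ultimately show ?thesis using that EV symE by blast
qed

section \<open>The pebble game\<close>

lemma image_mset_mset_set_bij:
  assumes "bij_betw b A B" "\<And>w. w \<in> A \<Longrightarrow> f w = g (b w)"
  shows "image_mset f (mset_set A) = image_mset g (mset_set B)"
proof -
  have "image_mset f (mset_set A) = image_mset (g \<circ> b) (mset_set A)"
  proof (rule image_mset_cong)
    fix w assume "w \<in># mset_set A"
    then have "w \<in> A" by (cases "finite A") auto
    then show "f w = (g \<circ> b) w" using assms(2) by simp
  qed
  also have "\<dots> = image_mset g (image_mset b (mset_set A))" by (simp add: multiset.map_comp)
  also have "image_mset b (mset_set A) = mset_set B"
    using assms(1) by (simp add: bij_betw_def image_mset_mset_set)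
  finally show ?thesis .
qed

text \<open>The bijective pebble game: \<open>R\<close> collects the positions from which Duplicator wins.\<close>

lemma wl_equivalent_if_game:
  fixes G :: "'a pair_pre_digraph" and H :: "'b pair_pre_digraph"
  assumes fin: "finite (pverts G)" "finite (pverts H)"
    and len: "\<And>x y. R x y \<Longrightarrow> length x = k \<and> length y = k"
    and atomic: "\<And>x y. R x y \<Longrightarrow> atomic_type G x = atomic_type H y"
    and step: "\<And>x y. R x y \<Longrightarrow> \<exists>b. bij_betw b (pverts G) (pverts H) \<and>
      (\<forall>w\<in>pverts G. (\<forall>i<k. R (x[i := w]) (y[i := b w])) \<and>
        atomic_type G (x @ [w]) = atomic_type H (y @ [b w]))"
    and start: "bij_betw \<Psi> (wl_tuples k G) (wl_tuples k H)" "\<And>x. x \<in> wl_tuples k G \<Longrightarrow> R x (\<Psi> x)"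
  shows "wl_equivalent k G H"
proof -
  have round: "wl_round k G r x = wl_round k H r y" if "R x y" for r x y
    using that
  proof (induction r arbitrary: x y)
    case 0
    then show ?case using atomic by simp
  next
    case (Suc r)
    from step[OF Suc.prems] obtain b where b: "bij_betw b (pverts G) (pverts H)"
      and R: "\<And>w i. w \<in> pverts G \<Longrightarrow> i < k \<Longrightarrow> R (x[i := w]) (y[i := b w])"
      and ext: "\<And>w. w \<in> pverts G \<Longrightarrow> atomic_type G (x @ [w]) = atomic_type H (y @ [b w])"
      by blast
    show ?case
    proof (cases "k = 1")
      case True
      with len[OF Suc.prems] obtain u v where xy: "x = [u]" "y = [v]"
        by (auto simp: length_Suc_conv)
      \<comment> \<open>For \<open>k = 1\<close> the refinement sees neighbours only, so
        \<open>b\<close> has to match the neighbours of \<open>u\<close> with those of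
        \<open>v\<close>; positions 0 and 1 of \<open>x @ [w]\<close> tell this.\<close>
      have adj: "(u, w) \<in> parcs G \<longleftrightarrow> (v, b w) \<in> parcs H" if "w \<in> pverts G" for w
      proof -
        have "(0, 1) \<in> {(i, j). i < length (x @ [w]) \<and> j < length (x @ [w]) \<and> ((x @ [w]) ! i, (x @ [w]) ! j) \<in> parcs G}
          \<longleftrightarrow> (0, 1) \<in> {(i, j). i < length (y @ [b w]) \<and> j < length (y @ [b w]) \<and> ((y @ [b w]) ! i, (y @ [b w]) ! j) \<in> parcs H}"
          using ext[OF that] unfolding atomic_type_def wl_color.inject by blast
        then show ?thesis by (simp add: xy)
      qed
      have "b ` {w \<in> pverts G. (u, w) \<in> parcs G} = {w \<in> pverts H. (v, w) \<in> parcs H}"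
        using adj unfolding bij_betw_imp_surj_on[OF b, symmetric] by auto
      moreover have "inj_on b {w \<in> pverts G. (u, w) \<in> parcs G}"
        using bij_betw_imp_inj_on[OF b] by (rule inj_on_subset) auto
      ultimately have "bij_betw b {w \<in> pverts G. (hd x, w) \<in> parcs G} {w \<in> pverts H. (hd y, w) \<in> parcs H}"
        by (simp add: xy bij_betw_def)
      moreover have "[wl_round k G r [w]] = [wl_round k H r [b w]]" if "w \<in> pverts G" for w
        using Suc.IH[OF R[OF that, of 0]] True by (simp add: xy)
      ultimately have "image_mset (\<lambda>w. [wl_round k G r [w]]) (mset_set {w \<in> pverts G. (hd x, w) \<in> parcs G}) =
          image_mset (\<lambda>w. [wl_round k H r [w]]) (mset_set {w \<in> pverts H. (hd y, w) \<in> parcs H})"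
        by (intro image_mset_mset_set_bij[of b]) auto
      then show ?thesis using Suc True by simp
    next
      case False
      have "image_mset (\<lambda>w. map (\<lambda>i. wl_round k G r (x[i := w])) [0..<k]) (mset_set (pverts G)) =
          image_mset (\<lambda>w. map (\<lambda>i. wl_round k H r (y[i := w])) [0..<k]) (mset_set (pverts H))"
        using Suc.IH[OF R] by (intro image_mset_mset_set_bij[OF b]) auto
      then show ?thesis using Suc False by simp
    qed
  qed
  show ?thesis
    unfolding wl_equivalent_iff_all_rounds[OF fin]
    using round start by (auto intro!: image_mset_mset_set_bij[OF start(1)])
qed

section \<open>Cai--Fuerer--Immerman graphs\<close>

lemma odd_card_sym_diff:
  assumes "finite A" "finite B"
  shows "odd (card (sym_diff A B)) \<longleftrightarrow> odd (card A) \<noteq> odd (card B)"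
proof -
  have "card (sym_diff A B) = card (A - B) + card (B - A)"
    using assms by (intro card_Un_disjoint) auto
  moreover have "card A = card (A \<inter> B) + card (A - B)" using assms(1) by (rule card_Int_Diff)
  moreover have "card B = card (A \<inter> B) + card (B - A)"
    using card_Int_Diff[OF assms(2), of A] by (simp add: Int_commute)
  ultimately show ?thesis by presburger
qed

text \<open>Handshake: arcs pair off with their reversals.\<close>

lemma even_card_sym_rel:
  fixes F :: "'a :: linorder rel"
  assumes "finite F" "sym F" "irrefl F"
  shows "even (card F)"
proof -
  let ?L = "{p \<in> F. fst p < snd p}"
  have "F = ?L \<union> ?L\<inverse>"
  proof (intro equalityI subsetI)
    fix p assume p: "p \<in> F"
    then have "(snd p, fst p) \<in> F" "fst p \<noteq> snd p"
      using assms(2,3) by (cases p; auto dest: symD irreflD)+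
    then show "p \<in> ?L \<union> ?L\<inverse>" using p by (cases p) auto
  next
    fix p assume "p \<in> ?L \<union> ?L\<inverse>"
    then show "p \<in> F" using assms(2) by (auto dest: symD)
  qed
  moreover have "?L \<inter> ?L\<inverse> = {}" by auto
  ultimately have "card F = card ?L + card (?L\<inverse>)"
    using assms(1) card_Un_disjoint[of ?L "?L\<inverse>"] by simp
  then show ?thesis by simp
qed

text \<open>An even subset of a nonempty \<open>S\<close> is determined by its part outside one
  fixed element.\<close>

lemma card_even_subsets_le:
  assumes "card S \<le> 3" "finite S"
  shows "card {X. X \<subseteq> S \<and> even (card X)} \<le> 4"
proof (cases "S = {}")
  case True
  then have "{X. X \<subseteq> S \<and> even (card X)} = {{}}" by auto
  then show ?thesis by simp
next
  case False
  then obtain s where s: "s \<in> S" by blast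
  have fin: "finite X" if "X \<subseteq> S" for X using that assms(2) finite_subset by blast
  have "inj_on (\<lambda>X. X - {s}) {X. X \<subseteq> S \<and> even (card X)}"
  proof (rule inj_onI)
    fix X Y assume X: "X \<in> {X. X \<subseteq> S \<and> even (card X)}" "Y \<in> {X. X \<subseteq> S \<and> even (card X)}"
      and eq: "X - {s} = Y - {s}"
    have "odd (card (Z - {s})) \<longleftrightarrow> s \<in> Z" if "Z \<subseteq> S" "even (card Z)" for Z
      using card.remove[OF fin[OF that(1)], of s] that(2) by (cases "s \<in> Z") auto
    from this[of X] this[of Y] X eq have "s \<in> X \<longleftrightarrow> s \<in> Y" by simp
    then show "X = Y" using eq by blast
  qed
  then have "card {X. X \<subseteq> S \<and> even (card X)} \<le> card (Pow (S - {s}))"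
    using assms(2) by (intro card_inj_on_le) auto
  also have "\<dots> = 2 ^ (card S - 1)" using s assms(2) by (simp add: card_Pow)
  also have "\<dots> \<le> 2 ^ 2" using assms(1) by (intro power_increasing) auto
  finally show ?thesis by simp
qed

text \<open>Pairs of a base vertex and a finite set are coded bijectively, so every number decodes,
  and \<open>base\<close> and \<open>fibre\<close> are total.\<close>

definition vert :: "nat \<Rightarrow> nat set \<Rightarrow> nat" where
  "vert v X = prod_encode (v, set_encode X)"

definition base :: "nat \<Rightarrow> nat" where
  "base p = fst (prod_decode p)"

definition fibre :: "nat \<Rightarrow> nat set" where
  "fibre p = set_decode (snd (prod_decode p))"

lemma base_vert [simp]: "base (vert v X) = v"
  by (simp add: base_def vert_def)

lemma fibre_vert [simp]: "finite X \<Longrightarrow> fibre (vert v X) = X"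
  by (simp add: fibre_def vert_def)

lemma vert_base_fibre [simp]: "vert (base p) (fibre p) = p"
  by (simp add: base_def fibre_def vert_def)

lemma finite_fibre [simp]: "finite (fibre p)"
  by (simp add: fibre_def)

lemma vert_eqI: "base p = base q \<Longrightarrow> fibre p = fibre q \<Longrightarrow> p = q"
  by (metis vert_base_fibre)

text \<open>The Cai--Fuerer--Immerman graph over the base graph \<open>(V, E)\<close> without edge gadgets:
  the gadget of \<open>v\<close> consists of the sets of neighbours of \<open>v\<close> of even size, or of odd size if \<open>v\<close> lies
  in the twist set \<open>U\<close>. An isolated untwisted \<open>v\<close> contributes one isolated vertex.\<close>

definition cfi :: "nat set \<Rightarrow> nat rel \<Rightarrow> nat set \<Rightarrow> nat pair_pre_digraph" where
  "cfi V E U =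
    (let P = {p. base p \<in> V \<and> fibre p \<subseteq> E `` {base p} \<and> (odd (card (fibre p)) \<longleftrightarrow> base p \<in> U)}
     in \<lparr>pverts = P, parcs = {(p, q). p \<in> P \<and> q \<in> P \<and> (base p, base q) \<in> E \<and>
          (base q \<in> fibre p \<longleftrightarrow> base p \<in> fibre q)}\<rparr>)"

lemma pverts_cfi: "p \<in> pverts (cfi V E U) \<longleftrightarrow>
    base p \<in> V \<and> fibre p \<subseteq> E `` {base p} \<and> (odd (card (fibre p)) \<longleftrightarrow> base p \<in> U)"
  by (simp add: cfi_def)

lemma parcs_cfi: "(p, q) \<in> parcs (cfi V E U) \<longleftrightarrow>
    p \<in> pverts (cfi V E U) \<and> q \<in> pverts (cfi V E U) \<and> (base p, base q) \<in> E \<and>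
    (base q \<in> fibre p \<longleftrightarrow> base p \<in> fibre q)"
  by (simp add: cfi_def)

text \<open>For symmetric \<open>F\<close> both ends of an edge are toggled together, so adjacency
  survives, while the parity in the gadget of \<open>v\<close> changes by the degree of
  \<open>v\<close> in \<open>F\<close>.\<close>

definition shift :: "nat rel \<Rightarrow> nat \<Rightarrow> nat" where
  "shift F p = vert (base p) (sym_diff (fibre p) (F `` {base p}))"

lemma base_shift [simp]: "base (shift F p) = base p"
  by (simp add: shift_def)

lemma shift_cong: "F `` {base p} = F' `` {base p} \<Longrightarrow> shift F p = shift F' p"
  by (simp add: shift_def)

text \<open>The set \<open>G\<close> of edges is a flow of the two-element field from \<open>s\<close> to \<open>t\<close> avoiding \<open>S\<close>. Working with
  flows instead of paths avoids any argument about walks: flows can simply be added.\<close>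

definition flow :: "nat rel \<Rightarrow> nat set \<Rightarrow> nat \<Rightarrow> nat \<Rightarrow> nat rel \<Rightarrow> bool" where
  "flow E S s t G \<longleftrightarrow> G \<subseteq> E \<and> sym G \<and> G `` S = {} \<and>
     (\<forall>v. odd (card (G `` {v})) \<longleftrightarrow> (v = s) \<noteq> (v = t))"

text \<open>In a base graph and for \<open>s\<close> outside \<open>S\<close>, this is the component
  of \<open>s\<close> after deleting \<open>S\<close>: the two vertices of odd degree of a flow lie
  in one component.\<close>

definition reach :: "nat rel \<Rightarrow> nat set \<Rightarrow> nat \<Rightarrow> nat set" where
  "reach E S s = {t. \<exists>G. flow E S s t G}"

locale base_graph =
  fixes V :: "nat set" and E :: "nat rel"
  assumes finite_V: "finite V" and E_subset: "E \<subseteq> V \<times> V" and sym_E: "sym E" and irrefl_E: "irrefl E"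
begin

lemma finite_E: "finite E"
  by (rule finite_subset[OF E_subset]) (simp add: finite_V)

lemma finite_Image: "F \<subseteq> E \<Longrightarrow> finite (F `` X)"
  by (rule finite_Image[OF finite_subset[OF _ finite_E]])

lemma fibre_shift: "F \<subseteq> E \<Longrightarrow> fibre (shift F p) = sym_diff (fibre p) (F `` {base p})"
  using finite_Image by (simp add: shift_def)

lemma shift_shift: "F \<subseteq> E \<Longrightarrow> shift F (shift F p) = p"
  by (rule vert_eqI) (auto simp: fibre_shift)

lemma inj_shift: "F \<subseteq> E \<Longrightarrow> inj (shift F)"
  using shift_shift by (intro injI) metis

lemma shift_in_cfi:
  assumes "p \<in> pverts (cfi V E U)" "F \<subseteq> E"
    "odd (card (F `` {base p})) \<longleftrightarrow> (base p \<in> U) \<noteq> (base p \<in> U')"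
  shows "shift F p \<in> pverts (cfi V E U')"
proof -
  have "odd (card (fibre (shift F p))) \<longleftrightarrow> base p \<in> U'"
    using assms finite_Image[OF assms(2)] by (simp add: fibre_shift odd_card_sym_diff pverts_cfi) blast
  moreover have "fibre (shift F p) \<subseteq> E `` {base p}"
    using assms by (auto simp: fibre_shift pverts_cfi)
  ultimately show ?thesis using assms(1) by (simp add: pverts_cfi)
qed

text \<open>Shifts are involutions that stay over their base vertex, so each gadget may use its own
  relation. Duplicator thus prepares one flow for each gadget that the next pebble may hit.\<close>

lemma bij_betw_shift:
  assumes F: "\<And>v. v \<in> V \<Longrightarrow> F v \<subseteq> E"
    "\<And>v. v \<in> V \<Longrightarrow> odd (card (F v `` {v})) \<longleftrightarrow> (v \<in> U) \<noteq> (v \<in> U')"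
  shows "bij_betw (\<lambda>p. shift (F (base p)) p) (pverts (cfi V E U)) (pverts (cfi V E U'))"
proof (rule bij_betw_byWitness[where f' = "\<lambda>p. shift (F (base p)) p"])
  have V: "base p \<in> V" if "p \<in> pverts (cfi V E W)" for p W using that by (simp add: pverts_cfi)
  show "\<forall>p\<in>pverts (cfi V E U). shift (F (base (shift (F (base p)) p))) (shift (F (base p)) p) = p"
    "\<forall>p\<in>pverts (cfi V E U'). shift (F (base (shift (F (base p)) p))) (shift (F (base p)) p) = p"
    using V F(1) by (auto simp: shift_shift)
  show "(\<lambda>p. shift (F (base p)) p) ` pverts (cfi V E U) \<subseteq> pverts (cfi V E U')"
    using V F by (intro image_subsetI shift_in_cfi[of _ U]) blast+
  show "(\<lambda>p. shift (F (base p)) p) ` pverts (cfi V E U') \<subseteq> pverts (cfi V E U)"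
    using V F by (intro image_subsetI shift_in_cfi[of _ U']) blast+
qed

lemma finite_cfi: "finite (pverts (cfi V E U))"
proof (rule finite_subset)
  show "pverts (cfi V E U) \<subseteq> (\<lambda>(v, X). vert v X) ` (V \<times> Pow V)"
  proof
    fix p assume "p \<in> pverts (cfi V E U)"
    then have "(base p, fibre p) \<in> V \<times> Pow V" using E_subset by (auto simp: pverts_cfi)
    then show "p \<in> (\<lambda>(v, X). vert v X) ` (V \<times> Pow V)"
      by (rule rev_image_eqI) simp
  qed
qed (simp add: finite_V)

lemma pair_graph_cfi: "pair_graph (cfi V E U)"
proof
  show "finite (pverts (cfi V E U))" by (rule finite_cfi)
  have sub: "parcs (cfi V E U) \<subseteq> pverts (cfi V E U) \<times> pverts (cfi V E U)"
    by (auto simp: parcs_cfi)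
  then show "finite (parcs (cfi V E U))"
    using finite_cfi finite_subset by blast
  show "fst e \<in> pverts (cfi V E U)" "snd e \<in> pverts (cfi V E U)" if "e \<in> parcs (cfi V E U)" for e
    using that sub by auto
  show "fst e \<noteq> snd e" if "e \<in> parcs (cfi V E U)" for e
    using that irrefl_E by (cases e) (auto simp: parcs_cfi irrefl_def)
  show "symmetric (with_proj (cfi V E U))"
    using sym_E by (auto simp: symmetric_def sym_def parcs_cfi)
qed

lemma card_cfi_le:
  assumes "\<And>v. v \<in> V \<Longrightarrow> card (E `` {v}) \<le> 3"
  shows "card (pverts (cfi V E {})) \<le> 4 * card V"
proof -
  let ?X = "\<lambda>v. {X. X \<subseteq> E `` {v} \<and> even (card X)}"
  have fin: "finite (?X v)" for v
    using finite_Image[of E "{v}"] by simp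
  have "pverts (cfi V E {}) \<subseteq> (\<Union>v\<in>V. vert v ` ?X v)"
  proof
    fix p assume "p \<in> pverts (cfi V E {})"
    then have p: "base p \<in> V" "fibre p \<in> ?X (base p)" by (auto simp: pverts_cfi)
    have "p \<in> vert (base p) ` ?X (base p)" using imageI[OF p(2), of "vert (base p)"] by (simp only: vert_base_fibre)
    with p(1) show "p \<in> (\<Union>v\<in>V. vert v ` ?X v)" by (rule UN_I)
  qed
  then have "card (pverts (cfi V E {})) \<le> card (\<Union>v\<in>V. vert v ` ?X v)"
    using finite_V fin by (intro card_mono) auto
  also have "\<dots> \<le> (\<Sum>v\<in>V. card (vert v ` ?X v))" by (rule card_UN_le[OF finite_V])
  also have "\<dots> \<le> (\<Sum>v\<in>V. 4)"
  proof (rule sum_mono)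
    fix v assume "v \<in> V"
    have "card (vert v ` ?X v) \<le> card (?X v)" by (rule card_image_le[OF fin])
    also have "\<dots> \<le> 4" using assms[OF \<open>v \<in> V\<close>] finite_Image[of E "{v}"] by (intro card_even_subsets_le) auto
    finally show "card (vert v ` ?X v) \<le> 4" .
  qed
  finally show ?thesis by simp
qed

section \<open>Adding flows, and reachability\<close>

text \<open>Degrees add modulo 2 under symmetric difference, so the common end \<open>b\<close>
  cancels.\<close>

lemma flow_add:
  assumes "flow E S a b G" "flow E S' b c H"
  shows "flow E (S \<inter> S') a c (sym_diff G H)"
proof -
  have GH: "G \<subseteq> E" "H \<subseteq> E" "sym G" "sym H" "G `` S = {}" "H `` S' = {}"
    using assms by (auto simp: flow_def)
  have im: "sym_diff G H `` {v} = sym_diff (G `` {v}) (H `` {v})" for v by auto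
  have "odd (card (sym_diff G H `` {v})) \<longleftrightarrow> (v = a) \<noteq> (v = c)" for v
    unfolding im odd_card_sym_diff[OF finite_Image[OF GH(1)] finite_Image[OF GH(2)]]
    using assms by (auto simp: flow_def)
  moreover have "sym (sym_diff G H)" using GH(3,4) by (auto simp: sym_def)
  moreover have "sym_diff G H `` (S \<inter> S') = {}" using GH(5,6) by blast
  ultimately show ?thesis using GH(1,2) unfolding flow_def by blast
qed

lemma flow_commute: "flow E S a b G \<longleftrightarrow> flow E S b a G"
  by (auto simp: flow_def)

lemma flow_mono: "flow E S a b G \<Longrightarrow> S' \<subseteq> S \<Longrightarrow> flow E S' a b G"
  unfolding flow_def by blast

lemma flow_edge:
  assumes "(a, b) \<in> E" "a \<notin> S" "b \<notin> S"
  shows "flow E S a b {(a, b), (b, a)}"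
proof -
  have "a \<noteq> b" using assms irrefl_E by (auto simp: irrefl_def)
  moreover have "{(a, b), (b, a)} `` {v} = (if v = a then {b} else if v = b then {a} else {})" for v
    by auto
  ultimately show ?thesis using assms sym_E by (auto simp: flow_def sym_def)
qed

lemma reach_refl: "t \<in> reach E S t"
proof -
  have "flow E S t t {}" by (simp add: flow_def sym_def)
  then show ?thesis by (auto simp: reach_def)
qed

lemma reachI: "flow E S s t G \<Longrightarrow> t \<in> reach E S s"
  unfolding reach_def mem_Collect_eq by (rule exI)

lemma reachE:
  assumes "t \<in> reach E S s"
  obtains G where "flow E S s t G"
  using assms unfolding reach_def mem_Collect_eq by (elim exE)

lemma reach_sym: "t \<in> reach E S s \<Longrightarrow> s \<in> reach E S t"
  by (erule reachE) (rule reachI, simp only: flow_commute)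

lemma reach_trans:
  assumes "b \<in> reach E S a" "c \<in> reach E S b"
  shows "c \<in> reach E S a"
proof -
  from assms obtain G H where "flow E S a b G" "flow E S b c H" by (elim reachE)
  from flow_add[OF this] have "flow E S a c (sym_diff G H)" by simp
  then show ?thesis by (rule reachI)
qed

lemma reach_mono: "S' \<subseteq> S \<Longrightarrow> reach E S t \<subseteq> reach E S' t"
  by (rule subsetI, erule reachE, rule reachI, rule flow_mono)

lemma reach_closed:
  assumes "x \<in> reach E S t" "x \<notin> S" "(x, y) \<in> E" "y \<notin> S"
  shows "y \<in> reach E S t"
  using assms(1) reachI[OF flow_edge[OF assms(3,2,4)]] by (rule reach_trans)

text \<open>No arc of a flow leaves such a \<open>t\<close>, so its degree there is 0 and its two
  ends coincide.\<close>

lemma reach_trivial: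
  assumes "t \<in> S \<or> t \<notin> V"
  shows "reach E S t = {t}"
proof -
  have "t' = t" if G: "flow E S t t' G" for t' G
  proof -
    have "G `` {t} = {}" using assms G E_subset by (auto simp: flow_def)
    then have "\<not> odd (card (G `` {t}))" by simp
    then show ?thesis using G unfolding flow_def by auto
  qed
  then show ?thesis using reach_refl by (auto simp: reach_def)
qed

lemma reach_subset: "t \<notin> S \<Longrightarrow> reach E S t \<subseteq> - S"
proof
  fix t' assume "t \<notin> S" "t' \<in> reach E S t"
  then show "t' \<in> - S" using reach_sym[of t' S t] reach_trivial[of t' S] by auto
qed

text \<open>The shift along \<open>F\<close> turns untwisted gadgets into those with the twist at
  \<open>r\<close>, except that the parity is wrong at \<open>t\<close>, where no vertex of
  \<open>x\<close> lies.\<close>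

lemma atomic_type_shift:
  assumes x: "set x \<subseteq> pverts (cfi V E {})" and F: "flow E {} r t F" and t: "t \<notin> base ` set x"
  shows "atomic_type (cfi V E {}) x = atomic_type (cfi V E {r}) (map (shift F) x)"
proof -
  have FE: "F \<subseteq> E" "sym F" using F by (auto simp: flow_def)
  have mem: "shift F p \<in> pverts (cfi V E {r})" if "p \<in> set x" for p
  proof (rule shift_in_cfi[OF _ FE(1)])
    show "p \<in> pverts (cfi V E {})" using that x by blast
    have "base p \<noteq> t" using that t by blast
    then show "odd (card (F `` {base p})) \<longleftrightarrow> (base p \<in> {}) \<noteq> (base p \<in> {r})"
      using F unfolding flow_def by auto
  qed
  have adj: "(p, q) \<in> parcs (cfi V E {}) \<longleftrightarrow> (shift F p, shift F q) \<in> parcs (cfi V E {r})"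
    if "p \<in> set x" "q \<in> set x" for p q
  proof -
    have "(base p, base q) \<in> F \<longleftrightarrow> (base q, base p) \<in> F" using FE(2) by (auto simp: sym_def)
    then have "(base q \<in> fibre p \<longleftrightarrow> base p \<in> fibre q) \<longleftrightarrow>
        (base q \<in> fibre (shift F p) \<longleftrightarrow> base p \<in> fibre (shift F q))"
      by (auto simp: fibre_shift[OF FE(1)])
    then show ?thesis using that x mem by (auto simp: parcs_cfi)
  qed
  show ?thesis
    using adj inj_shift[OF FE(1)] by (auto simp: atomic_type_def inj_eq)
qed

text \<open>The fibres form a symmetric subrelation of \<open>E\<close>; its size is the sum of the
  fibre sizes and even by the handshake argument.\<close>

lemma even_card_odd_fibres:
  assumes F: "\<And>x. x \<in> V \<Longrightarrow> fibre (h x) \<subseteq> E `` {x}"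
    and sym: "\<And>x y. (x, y) \<in> E \<Longrightarrow> y \<in> fibre (h x) \<longleftrightarrow> x \<in> fibre (h y)"
  shows "even (card {x \<in> V. odd (card (fibre (h x)))})"
proof -
  let ?F = "Sigma V (\<lambda>x. fibre (h x))"
  have sub: "?F \<subseteq> E" using F by auto
  have "sym ?F"
  proof (rule symI)
    fix x y assume xy: "(x, y) \<in> ?F"
    then have "(x, y) \<in> E" using sub by blast
    then show "(y, x) \<in> ?F" using xy sym[of x y] E_subset by auto
  qed
  moreover have "finite ?F" "irrefl ?F"
    using sub finite_E irrefl_E by (auto intro: finite_subset simp: irrefl_def)
  ultimately have "even (card ?F)" by (intro even_card_sym_rel)
  also have "card ?F = (\<Sum>x\<in>V. card (fibre (h x)))"
    using finite_V by (intro card_SigmaI) auto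
  finally show ?thesis using finite_V by (simp add: even_sum_iff)
qed

section \<open>Non-isomorphism by counting homomorphisms\<close>

definition homs :: "nat set \<Rightarrow> (nat \<Rightarrow> nat) set" where
  "homs U = {h \<in> V \<rightarrow>\<^sub>E pverts (cfi V E U). \<forall>(x, y)\<in>E. (h x, h y) \<in> parcs (cfi V E U)}"

lemma finite_homs: "finite (homs U)"
  by (rule finite_subset[OF _ finite_PiE[OF finite_V, of "\<lambda>_. pverts (cfi V E U)"]])
    (auto simp: homs_def finite_cfi)

text \<open>The homomorphisms from the base graph to a CFI graph that lie over a given map \<open>V \<rightarrow> V\<close> are the
  solutions of a linear system over the two-element field, whose homogeneous version belongs to the
  untwisted graph. So the untwisted graph has at least as many of them, and it has more over
  the identity, where the twisted system is unsolvable.\<close>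

lemma card_homs_less:
  assumes r: "r \<in> V"
  shows "card (homs {r}) < card (homs {})"
proof -
  define proj where "proj h = restrict (base \<circ> h) V" for h
  \<comment> \<open>\<open>sel\<close> fixes one twisted solution over each projection that has one;
    \<open>\<Phi>\<close> adds it to \<open>h\<close>, which cancels the twist.\<close>
  define sel where "sel \<phi> = (SOME h. h \<in> homs {r} \<and> proj h = \<phi>)" for \<phi>
  define \<Phi> where "\<Phi> h = (\<lambda>x\<in>V. vert (base (h x)) (sym_diff (fibre (h x)) (fibre (sel (proj h) x))))" for h
  have sel: "sel (proj h) \<in> homs {r} \<and> proj (sel (proj h)) = proj h" if "h \<in> homs {r}" for h
    unfolding sel_def by (rule someI[of _ h]) (use that in simp)
  have proj_sel: "base (sel (proj h) x) = base (h x)" if "h \<in> homs {r}" "x \<in> V" for h x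
    using fun_cong[OF conjunct2[OF sel[OF that(1)]], of x] that(2) by (simp add: proj_def)
  have base\<Phi>: "base (\<Phi> h x) = base (h x)" if "x \<in> V" for h x
    using that by (simp add: \<Phi>_def)
  have fibre\<Phi>: "fibre (\<Phi> h x) = sym_diff (fibre (h x)) (fibre (sel (proj h) x))" if "x \<in> V" for h x
    using that by (simp add: \<Phi>_def)
  have ver: "h x \<in> pverts (cfi V E U)" if "h \<in> homs U" "x \<in> V" for h x U
    using that by (auto simp: homs_def)
  have arc: "(h x, h y) \<in> parcs (cfi V E U)" if "h \<in> homs U" "(x, y) \<in> E" for h x y U
    using that by (auto simp: homs_def)
  have into: "\<Phi> h \<in> homs {}" if h: "h \<in> homs {r}" for h
  proof -
    let ?l = "sel (proj h)"
    have l: "?l \<in> homs {r}" using sel[OF h] by blast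
    have mem: "\<Phi> h x \<in> pverts (cfi V E {})" if x: "x \<in> V" for x
      using ver[OF h x] ver[OF l x] proj_sel[OF h x]
      by (auto simp: pverts_cfi base\<Phi>[OF x] fibre\<Phi>[OF x] odd_card_sym_diff)
    have "(\<Phi> h x, \<Phi> h y) \<in> parcs (cfi V E {})" if xy: "(x, y) \<in> E" for x y
    proof -
      have V: "x \<in> V" "y \<in> V" using xy E_subset by auto
      have "(base (h x), base (h y)) \<in> E" "base (h y) \<in> fibre (h x) \<longleftrightarrow> base (h x) \<in> fibre (h y)"
        "base (h y) \<in> fibre (?l x) \<longleftrightarrow> base (h x) \<in> fibre (?l y)"
        using arc[OF h xy] arc[OF l xy] proj_sel[OF h] V by (auto simp: parcs_cfi)
      then show ?thesis using mem V by (auto simp: parcs_cfi base\<Phi> fibre\<Phi>)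
    qed
    moreover have "\<Phi> h \<in> extensional V" by (simp add: \<Phi>_def)
    ultimately show ?thesis using mem unfolding homs_def by (auto simp: PiE_def)
  qed
  have "inj_on \<Phi> (homs {r})"
  proof (rule inj_onI)
    fix h h' assume h: "h \<in> homs {r}" "h' \<in> homs {r}" and eq: "\<Phi> h = \<Phi> h'"
    have b: "base (h x) = base (h' x)" if "x \<in> V" for x
      using base\<Phi>[OF that] eq by metis
    then have p: "proj h = proj h'" by (auto simp: proj_def)
    have "h x = h' x" if x: "x \<in> V" for x
    proof (rule vert_eqI[OF b[OF x]])
      have "sym_diff (fibre (h x)) (fibre (sel (proj h) x)) = sym_diff (fibre (h' x)) (fibre (sel (proj h) x))"
        using fibre\<Phi>[OF x, of h] fibre\<Phi>[OF x, of h'] eq p by simp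
      then show "fibre (h x) = fibre (h' x)" by blast
    qed
    then show "h = h'" using h by (auto simp: homs_def intro: PiE_ext)
  qed
  then have "card (homs {r}) = card (\<Phi> ` homs {r})" by (simp add: card_image)
  also have "\<dots> < card (homs {})"
  proof (rule psubset_card_mono[OF finite_homs])
    \<comment> \<open>The zero solution over the identity. A preimage under \<open>\<Phi>\<close>
      would also lie over the identity, with an odd fibre at \<open>r\<close> alone, against
      parity.\<close>
    let ?h = "\<lambda>x\<in>V. vert x {}"
    have "?h \<in> homs {}"
      using E_subset by (auto simp: homs_def parcs_cfi pverts_cfi)
    moreover have "?h \<noteq> \<Phi> h" if h: "h \<in> homs {r}" for h
    proof
      assume eq: "?h = \<Phi> h"
      have b: "base (h x) = x" if "x \<in> V" for x
        using base\<Phi>[OF that, of h] that unfolding eq[symmetric] by simp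
      have "even (card {x \<in> V. odd (card (fibre (h x)))})"
      proof (rule even_card_odd_fibres)
        fix x assume "x \<in> V"
        then show "fibre (h x) \<subseteq> E `` {x}" using ver[OF h] b by (metis pverts_cfi)
      next
        fix x y assume xy: "(x, y) \<in> E"
        then have "x \<in> V" "y \<in> V" using E_subset by auto
        with arc[OF h xy] b show "y \<in> fibre (h x) \<longleftrightarrow> x \<in> fibre (h y)" by (simp add: parcs_cfi)
      qed
      moreover have "{x \<in> V. odd (card (fibre (h x)))} = {r}"
        using ver[OF h] b r by (auto simp: pverts_cfi)
      ultimately show False by simp
    qed
    ultimately show "\<Phi> ` homs {r} \<subset> homs {}" using into by blast
  qed
  finally show ?thesis .
qed

text \<open>Composition with an isomorphism would embed \<open>homs {}\<close> into
  \<open>homs {r}\<close>.\<close>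

lemma cfi_not_iso:
  assumes "r \<in> V"
  shows "\<not> digraph_iso (with_proj (cfi V E {})) (with_proj (cfi V E {r}))"
proof
  assume "digraph_iso (with_proj (cfi V E {})) (with_proj (cfi V E {r}))"
  then obtain f where f: "bij_betw f (pverts (cfi V E {})) (pverts (cfi V E {r}))"
    and arcs: "\<And>p q. p \<in> pverts (cfi V E {}) \<Longrightarrow> q \<in> pverts (cfi V E {}) \<Longrightarrow>
      (p, q) \<in> parcs (cfi V E {}) \<longleftrightarrow> (f p, f q) \<in> parcs (cfi V E {r})"
    unfolding digraph_iso_pair_graph_iff[OF pair_graph_cfi pair_graph_cfi] by blast
  have "card (homs {}) \<le> card (homs {r})"
  proof (rule card_inj_on_le[OF _ _ finite_homs])
    let ?c = "\<lambda>h. restrict (f \<circ> h) V"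
    show "inj_on ?c (homs {})"
    proof (rule inj_onI)
      fix h h' assume h: "h \<in> homs {}" "h' \<in> homs {}" and eq: "?c h = ?c h'"
      have "h x = h' x" if x: "x \<in> V" for x
      proof -
        have "f (h x) = f (h' x)" using fun_cong[OF eq, of x] x by simp
        moreover have "h x \<in> pverts (cfi V E {})" "h' x \<in> pverts (cfi V E {})"
          using h x by (auto simp: homs_def)
        ultimately show ?thesis using f by (auto simp: bij_betw_def inj_on_def)
      qed
      then show "h = h'" using h by (auto simp: homs_def intro: PiE_ext)
    qed
    show "?c ` homs {} \<subseteq> homs {r}"
    proof
      fix g assume "g \<in> ?c ` homs {}"
      then obtain h where h: "h \<in> homs {}" and g: "g = ?c h" by blast
      have v: "h x \<in> pverts (cfi V E {})" if "x \<in> V" for x using h that by (auto simp: homs_def)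
      have "(f (h x), f (h y)) \<in> parcs (cfi V E {r})" if xy: "(x, y) \<in> E" for x y
      proof -
        have "x \<in> V" "y \<in> V" using xy E_subset by auto
        moreover have "(h x, h y) \<in> parcs (cfi V E {})" using h xy by (auto simp: homs_def)
        ultimately show ?thesis using arcs v by blast
      qed
      then show "g \<in> homs {r}"
        using v bij_betw_apply[OF f] E_subset unfolding g homs_def by auto
    qed
  qed
  then show False using card_homs_less[OF assms] by simp
qed

end

text \<open>The predicate \<open>giant\<close> is a haven: it tells which vertices the twist may sit at while
  the gadgets in \<open>S\<close> carry pebbles.\<close>

locale haven_graph = base_graph +
  fixes giant :: "nat set \<Rightarrow> nat \<Rightarrow> bool" and u :: nat and r :: nat
  assumes giant_exists: "finite S \<Longrightarrow> card S \<le> u \<Longrightarrow> \<exists>t. giant S t"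
    and giant_notin: "giant S t \<Longrightarrow> t \<notin> S"
    and giant_mono: "giant S t \<Longrightarrow> S' \<subseteq> S \<Longrightarrow> giant S' t"
    and giant_reach: "giant S t \<Longrightarrow> giant S' t' \<Longrightarrow> S \<subseteq> S' \<Longrightarrow> t' \<in> reach E S t"
    and giant_root: "giant {} r"
begin

section \<open>Duplicator's strategy\<close>

text \<open>Duplicator's invariant: the twist has been moved along \<open>F\<close> from
  \<open>r\<close> to a haven vertex \<open>t\<close> off the pebbled gadgets.\<close>

definition position :: "nat \<Rightarrow> nat list \<Rightarrow> nat list \<Rightarrow> bool" where
  "position k x y \<longleftrightarrow> x \<in> wl_tuples k (cfi V E {}) \<and>
     (\<exists>F t. flow E {} r t F \<and> giant (base ` set x) t \<and> y = map (shift F) x)"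

lemma flow_parity:
  assumes "flow E {} r t F" "v \<noteq> t"
  shows "odd (card (F `` {v})) \<longleftrightarrow> (v \<in> {}) \<noteq> (v \<in> {r})" "odd (card (F `` {v})) \<longleftrightarrow> (v \<in> {r}) \<noteq> (v \<in> {})"
  using assms by (auto simp: flow_def)

text \<open>For each base vertex \<open>v\<close> the twist is moved on to a haven vertex that also
  avoids \<open>v\<close>. The added flow has no arc at the pebbled gadgets, so earlier answers
  persist. \<open>Suc k\<close> counts the new vertex before a pebble is lifted.\<close>

lemma position_step:
  assumes pos: "position k x y" and k: "Suc k \<le> u"
  shows "\<exists>b. bij_betw b (pverts (cfi V E {})) (pverts (cfi V E {r})) \<and>
    (\<forall>w\<in>pverts (cfi V E {}). (\<forall>i<k. position k (x[i := w]) (y[i := b w])) \<and>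
      atomic_type (cfi V E {}) (x @ [w]) = atomic_type (cfi V E {r}) (y @ [b w]))"
proof -
  from pos obtain F t where x: "x \<in> wl_tuples k (cfi V E {})" and F: "flow E {} r t F"
    and t: "giant (base ` set x) t" and y: "y = map (shift F) x"
    unfolding position_def by blast
  let ?S = "base ` set x"
  have "length x = k" using x by (simp add: wl_tuples_def)
  then have cardS: "card ?S \<le> k"
    using card_image_le[of "set x" base] card_length[of x] by simp
  have "\<exists>F' t'. flow E {} r t' F' \<and> giant (insert v ?S) t' \<and> (\<forall>s\<in>?S. F' `` {s} = F `` {s})" for v
  proof -
    have "card (insert v ?S) \<le> u" using cardS k card_insert_le_m1[of "Suc k" ?S v] by simp
    then obtain t' where t': "giant (insert v ?S) t'" using giant_exists[of "insert v ?S"] by auto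
    then have "t' \<in> reach E ?S t" by (rule giant_reach[OF t]) auto
    then obtain G where G: "flow E ?S t t' G" by (auto simp: reach_def)
    have "flow E {} r t' (sym_diff F G)" using flow_add[OF F G] by simp
    moreover have "sym_diff F G `` {s} = F `` {s}" if "s \<in> ?S" for s
      using G that unfolding flow_def by blast
    ultimately show ?thesis using t' by blast
  qed
  then obtain F' t' where F': "\<And>v. flow E {} r (t' v) (F' v)" "\<And>v. giant (insert v ?S) (t' v)"
    "\<And>v s. s \<in> ?S \<Longrightarrow> F' v `` {s} = F `` {s}"
    by metis
  let ?b = "\<lambda>p. shift (F' (base p)) p"
  have y': "y = map (shift (F' v)) x" for v
    unfolding y using F'(3)[of _ v] by (auto intro!: shift_cong)
  have notin: "t' v \<notin> insert v ?S" for v using F'(2) by (rule giant_notin)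
  have "bij_betw ?b (pverts (cfi V E {})) (pverts (cfi V E {r}))"
  proof (rule bij_betw_shift)
    show "F' v \<subseteq> E" for v using F'(1) by (auto simp: flow_def)
    show "odd (card (F' v `` {v})) \<longleftrightarrow> (v \<in> {}) \<noteq> (v \<in> {r})" for v
      using notin[of v] by (intro flow_parity(1)[OF F'(1)]) auto
  qed
  moreover have "position k (x[i := w]) (y[i := ?b w])" if w: "w \<in> pverts (cfi V E {})" and i: "i < k" for w i
    unfolding position_def
  proof (intro conjI exI)
    have sub: "set (x[i := w]) \<subseteq> insert w (set x)" by (rule set_update_subset_insert)
    then show "x[i := w] \<in> wl_tuples k (cfi V E {})" using x w by (auto simp: wl_tuples_def)
    show "flow E {} r (t' (base w)) (F' (base w))" by (rule F'(1))
    \<comment> \<open>Lifting the pebble from coordinate \<open>i\<close> can only shrink the set of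
      pebbled gadgets.\<close>
    show "giant (base ` set (x[i := w])) (t' (base w))"
      using sub by (intro giant_mono[OF F'(2)]) auto
    show "y[i := ?b w] = map (shift (F' (base w))) (x[i := w])"
      by (simp add: map_update y'[of "base w"])
  qed
  moreover have "atomic_type (cfi V E {}) (x @ [w]) = atomic_type (cfi V E {r}) (y @ [?b w])"
    if w: "w \<in> pverts (cfi V E {})" for w
    using atomic_type_shift[of "x @ [w]", OF _ F'(1)[of "base w"]] notin[of "base w"] x w y'[of "base w"]
    by (auto simp: wl_tuples_def)
  ultimately show ?thesis by blast
qed

text \<open>The initial flow depends only on the set of pebbled gadgets, which shifts preserve.
  Hence the map on tuples is an involution and serves in both directions.\<close>

lemma cfi_wl_equivalent:
  assumes k: "Suc k \<le> u"
  shows "wl_equivalent k (cfi V E {}) (cfi V E {r})"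
proof -
  have "\<exists>F t. card S \<le> k \<and> finite S \<longrightarrow> flow E {} r t F \<and> giant S t" for S
  proof (cases "card S \<le> k \<and> finite S")
    case True
    then obtain t where t: "giant S t" using giant_exists[of S] k by auto
    then have "t \<in> reach E {} r" by (rule giant_reach[OF giant_root]) simp
    then show ?thesis using t by (auto simp: reach_def)
  qed blast
  then obtain F t where F: "\<And>S. card S \<le> k \<Longrightarrow> finite S \<Longrightarrow> flow E {} r (t S) (F S) \<and> giant S (t S)"
    by metis
  let ?\<Psi> = "\<lambda>x. map (shift (F (base ` set x))) x"
  have good: "flow E {} r (t (base ` set x)) (F (base ` set x))" "giant (base ` set x) (t (base ` set x))"
    if "x \<in> wl_tuples k G" for x G
  proof -
    have "card (base ` set x) \<le> k"
      using that card_image_le[of "set x" base] card_length[of x] by (simp add: wl_tuples_def)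
    then show "flow E {} r (t (base ` set x)) (F (base ` set x))" "giant (base ` set x) (t (base ` set x))"
      using F[of "base ` set x"] by auto
  qed
  have sub: "F (base ` set x) \<subseteq> E" if "x \<in> wl_tuples k G" for x G
    using good(1)[OF that] by (auto simp: flow_def)
  have ne: "base p \<noteq> t (base ` set x)" if "x \<in> wl_tuples k G" "p \<in> set x" for x p G
    using giant_notin[OF good(2)[OF that(1)]] that(2) by (metis imageI)
  have img: "base ` set (?\<Psi> x) = base ` set x" for x by (simp add: image_image)
  have inv: "?\<Psi> (?\<Psi> x) = x" if "x \<in> wl_tuples k G" for x G
    using shift_shift[OF sub[OF that]] unfolding img by (simp add: map_idI)
  have into: "?\<Psi> x \<in> wl_tuples k (cfi V E U')"
    if x: "x \<in> wl_tuples k (cfi V E U)"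
      and U: "\<And>v. v \<noteq> t (base ` set x) \<Longrightarrow> odd (card (F (base ` set x) `` {v})) \<longleftrightarrow> (v \<in> U) \<noteq> (v \<in> U')" for x U U'
  proof -
    have "shift (F (base ` set x)) p \<in> pverts (cfi V E U')" if "p \<in> set x" for p
      using x that U[OF ne[OF x that]] by (intro shift_in_cfi[OF _ sub[OF x]]) (auto simp: wl_tuples_def)
    then show ?thesis using x by (auto simp: wl_tuples_def)
  qed
  have "bij_betw ?\<Psi> (wl_tuples k (cfi V E {})) (wl_tuples k (cfi V E {r}))"
  proof (rule bij_betw_byWitness[where f' = ?\<Psi>])
    show "\<forall>x\<in>wl_tuples k (cfi V E {}). ?\<Psi> (?\<Psi> x) = x" "\<forall>x\<in>wl_tuples k (cfi V E {r}). ?\<Psi> (?\<Psi> x) = x"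
      by (rule ballI, erule inv)+
    show "?\<Psi> ` wl_tuples k (cfi V E {}) \<subseteq> wl_tuples k (cfi V E {r})"
      using flow_parity(1)[OF good(1)] by (intro image_subsetI into) auto
    show "?\<Psi> ` wl_tuples k (cfi V E {r}) \<subseteq> wl_tuples k (cfi V E {})"
      using flow_parity(2)[OF good(1)] by (intro image_subsetI into) auto
  qed
  moreover have "position k x (?\<Psi> x)" if "x \<in> wl_tuples k (cfi V E {})" for x
    using that good[OF that] unfolding position_def by blast
  moreover have "atomic_type (cfi V E {}) x = atomic_type (cfi V E {r}) y" if "position k x y" for x y
    using that giant_notin unfolding position_def wl_tuples_def by (auto intro!: atomic_type_shift)
  moreover have "length x = k \<and> length y = k" if "position k x y" for x y
    using that by (auto simp: position_def wl_tuples_def)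
  ultimately show ?thesis
    using position_step[OF _ k] finite_cfi by (intro wl_equivalent_if_game[where R = "position k"]) auto
qed

end

section \<open>Havens from vertex separation\<close>

locale separator_graph = base_graph C E for C :: "nat set" and E :: "nat rel" +
  fixes u :: nat
  assumes u_pos: "u > 0" and card_C: "card C = 24 * u"
    and separation: "S \<subseteq> C \<Longrightarrow> card S = u \<Longrightarrow> A \<subseteq> C - S \<Longrightarrow> E `` A \<subseteq> A \<union> S \<Longrightarrow>
      card A < 6 * u \<or> 17 * u < card A"
begin

text \<open>The threshold is half of \<open>card C\<close>, so any two such components meet.\<close>

definition giant :: "nat set \<Rightarrow> nat \<Rightarrow> bool" where
  "giant S t \<longleftrightarrow> 12 * u < card (reach E S t \<inter> C)"

lemma giant_nontrivial:
  assumes "giant S t"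
  shows "t \<notin> S" "t \<in> C"
proof -
  have "reach E S t \<noteq> {t}"
  proof
    assume "reach E S t = {t}"
    then have "card (reach E S t \<inter> C) \<le> card {t}" by (intro card_mono) auto
    then show False using assms u_pos by (simp add: giant_def)
  qed
  then show "t \<notin> S" "t \<in> C" using reach_trivial by blast+
qed

text \<open>All arcs lie within \<open>C\<close>, so pebbles on padding vertices outside
  \<open>C\<close> obstruct no flow.\<close>

lemma giant_antimono:
  assumes "giant S t" "S' \<inter> C \<subseteq> S"
  shows "giant S' t"
proof -
  have "reach E S t \<subseteq> reach E S' t"
  proof
    fix x assume "x \<in> reach E S t"
    then obtain G where "flow E S t x G" by (rule reachE)
    then have "flow E S' t x G" using assms(2) E_subset unfolding flow_def by blast
    then show "x \<in> reach E S' t" by (rule reachI)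
  qed
  then have "card (reach E S t \<inter> C) \<le> card (reach E S' t \<inter> C)"
    using finite_V by (intro card_mono) auto
  then show ?thesis using assms(1) by (simp add: giant_def)
qed

text \<open>A common vertex of the two components is joined to \<open>t'\<close> avoiding
  \<open>S'\<close>, hence also avoiding the smaller set \<open>S\<close>.\<close>

lemma giant_meet:
  assumes "giant S t" "giant S' t'" "S \<subseteq> S'"
  shows "t' \<in> reach E S t"
proof -
  let ?K = "reach E S t \<inter> C" and ?K' = "reach E S' t' \<inter> C"
  have "?K \<inter> ?K' \<noteq> {}"
  proof
    assume "?K \<inter> ?K' = {}"
    then have "card (?K \<union> ?K') = card ?K + card ?K'" using finite_V by (intro card_Un_disjoint) auto
    moreover have "card (?K \<union> ?K') \<le> 24 * u"
      using finite_V card_C by (metis Int_lower2 Un_least card_mono)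
    ultimately show False using assms(1,2) unfolding giant_def by linarith
  qed
  then obtain x where "x \<in> reach E S t" "x \<in> reach E S' t'" by blast
  moreover from this(2) have "x \<in> reach E S t'" using reach_mono[OF assms(3)] by blast
  ultimately show ?thesis using reach_sym reach_trans by blast
qed

text \<open>Take a smallest closed set \<open>A\<close> with at least \<open>6 * u\<close> vertices;
  by separation it has more than \<open>17 * u\<close>. A component inside \<open>A\<close> that is
  not giant has fewer than \<open>6 * u\<close>, so removing it leaves a smaller closed set that is
  still large enough.\<close>

lemma giant_exists_exact:
  assumes S: "S \<subseteq> C" "card S = u"
  shows "\<exists>t. giant S t"
proof (rule ccontr)
  assume no: "\<nexists>t. giant S t"
  define closed where "closed A \<longleftrightarrow> A \<subseteq> C - S \<and> E `` A \<subseteq> A \<union> S" for A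
  have dich: "card A < 6 * u \<or> 17 * u < card A" if "closed A" for A
    using separation[OF S] that by (auto simp: closed_def)
  have "closed (C - S)" using E_subset by (auto simp: closed_def)
  moreover have "6 * u \<le> card (C - S)"
    using S card_C finite_V finite_subset by (subst card_Diff_subset) auto
  ultimately obtain A where A: "closed A" "6 * u \<le> card A"
    and min: "\<And>B. closed B \<Longrightarrow> 6 * u \<le> card B \<Longrightarrow> card A \<le> card B"
    using ex_has_least_nat[of "\<lambda>A. closed A \<and> 6 * u \<le> card A" "C - S" card] by blast
  have finA: "finite A" using A(1) finite_V finite_subset by (auto simp: closed_def)
  have "17 * u < card A" using dich[OF A(1)] A(2) by linarith
  then obtain t where t: "t \<in> A" using card_gt_0_iff[of A] by auto
  then have tC: "t \<in> C - S" using A(1) by (auto simp: closed_def)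
  let ?K = "reach E S t \<inter> C"
  have K: "closed ?K"
    unfolding closed_def
  proof
    show "?K \<subseteq> C - S" using reach_subset[of t S] tC by auto
    show "E `` ?K \<subseteq> ?K \<union> S"
    proof
      fix y assume "y \<in> E `` ?K"
      then obtain x where x: "x \<in> reach E S t" "(x, y) \<in> E" by blast
      then have "x \<notin> S" using reach_subset[of t S] tC by auto
      then show "y \<in> ?K \<union> S" using x reach_closed[OF x(1) _ x(2)] E_subset by auto
    qed
  qed
  have "\<not> 12 * u < card ?K" using no by (auto simp: giant_def)
  then have small: "card ?K < 6 * u" using dich[OF K] by linarith
  have "closed (A - ?K)"
    unfolding closed_def
  proof
    show "A - ?K \<subseteq> C - S" using A(1) by (auto simp: closed_def)
    show "E `` (A - ?K) \<subseteq> (A - ?K) \<union> S"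
    proof
      fix y assume "y \<in> E `` (A - ?K)"
      then obtain x where x: "x \<in> A" "x \<notin> ?K" "(x, y) \<in> E" by blast
      have "y \<notin> ?K"
      proof
        assume "y \<in> ?K"
        then have "x \<in> ?K \<union> S" using K sym_E x(3) unfolding closed_def sym_def by blast
        then show False using x A(1) by (auto simp: closed_def)
      qed
      then show "y \<in> (A - ?K) \<union> S" using x A(1) by (auto simp: closed_def)
    qed
  qed
  moreover have "card A - card ?K \<le> card (A - ?K)"
    using finite_V by (intro diff_card_le_card_Diff) simp
  then have "6 * u \<le> card (A - ?K)" using small \<open>17 * u < card A\<close> by linarith
  ultimately have "card A \<le> card (A - ?K)" by (rule min)
  moreover have "card (A - ?K) < card A"
    using t tC reach_refl finA by (intro psubset_card_mono) auto
  ultimately show False by simp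
qed

text \<open>Enlarge the part of \<open>S\<close> in \<open>C\<close> to exactly \<open>u\<close>
  vertices.\<close>

lemma giant_exists:
  assumes "finite S" "card S \<le> u"
  shows "\<exists>t. giant S t"
proof -
  have "card (S \<inter> C) \<le> u" using assms card_mono[of S "S \<inter> C"] by simp
  then obtain T where "S \<inter> C \<subseteq> T" "T \<subseteq> C" "card T = u"
    using exists_subset_between[of "S \<inter> C" u C] card_C finite_V by auto
  then show ?thesis using giant_exists_exact giant_antimono by blast
qed

end

section \<open>Padding and choice of parameters\<close>

lemma card_cfi_isolated:
  assumes "base_graph C E" "C \<subseteq> V" "finite V"
  shows "card (pverts (cfi V E {})) = card (pverts (cfi C E {})) + card (V - C)"
proof -
  interpret base_graph C E by fact
  have iso: "E `` {v} = {}" if "v \<notin> C" for v using that E_subset by auto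
  have "pverts (cfi V E {}) = pverts (cfi C E {}) \<union> (\<lambda>v. vert v {}) ` (V - C)"
  proof (intro equalityI subsetI)
    fix p assume p: "p \<in> pverts (cfi V E {})"
    show "p \<in> pverts (cfi C E {}) \<union> (\<lambda>v. vert v {}) ` (V - C)"
    proof (cases "base p \<in> C")
      case True
      then show ?thesis using p by (simp add: pverts_cfi)
    next
      case False
      then have "fibre p = {}" "base p \<in> V - C" using p iso[OF False] by (auto simp: pverts_cfi)
      then show ?thesis using vert_base_fibre[of p] by (metis UnI2 imageI)
    qed
  next
    fix p assume "p \<in> pverts (cfi C E {}) \<union> (\<lambda>v. vert v {}) ` (V - C)"
    then show "p \<in> pverts (cfi V E {})" using assms(2) by (auto simp: pverts_cfi)
  qed
  moreover have "pverts (cfi C E {}) \<inter> (\<lambda>v. vert v {}) ` (V - C) = {}" by (auto simp: pverts_cfi)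
  moreover have "inj_on (\<lambda>v. vert v {}) (V - C)" by (metis base_vert inj_onI)
  ultimately show ?thesis
    using finite_cfi assms(3) by (simp add: card_Un_disjoint card_image)
qed

theorem theorem36:
  shows "\<exists>n\<^sub>0::nat. \<forall>n\<ge>n\<^sub>0. 8 dvd n \<longrightarrow>
    (\<exists>(G :: nat pair_pre_digraph) (H :: nat pair_pre_digraph).
       pair_graph G \<and> pair_graph H \<and>
       card (pverts G) = n \<and> card (pverts H) = n \<and>
       \<not> digraph_iso (with_proj G) (with_proj H) \<and>
       (\<forall>k::nat. k \<ge> 1 \<and> real k < 1 / 96 * real n - 1 \<longrightarrow> wl_equivalent k G H))"
proof (intro exI[of _ 192] allI impI)
  fix n :: nat assume n: "192 \<le> n"
  \<comment> \<open>The threshold \<open>192 = 2 * 96\<close> gives \<open>u \<ge> 2\<close>, as the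
    union bound requires.\<close>
  define u where "u = n div 96"
  have u: "u \<ge> 2" "96 * u \<le> n" using n by (auto simp: u_def)
  let ?C = "{..<24 * u}"
  from expanding_graph_exists[OF u(1)] obtain E :: "nat rel"
    where E: "E \<subseteq> ?C \<times> ?C" "sym E" "irrefl E" and deg: "\<And>v. card (E `` {v}) \<le> 3"
      and sep: "\<And>S A. S \<subseteq> ?C \<Longrightarrow> card S = u \<Longrightarrow> A \<subseteq> ?C - S \<Longrightarrow>
         E `` A \<subseteq> A \<union> S \<Longrightarrow> card A < 6 * u \<or> 17 * u < card A"
    by blast
  interpret C: separator_graph ?C E u
    by unfold_locales (use E u sep in simp_all)
  define c where "c = card (pverts (cfi ?C E {}))"
  \<comment> \<open>There are \<open>24 * u\<close> gadgets of at most 4 vertices, so at most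
    \<open>96 * u\<close> vertices.\<close>
  have c: "c \<le> n" using C.card_cfi_le[OF deg] u(2) by (simp add: c_def)
  define V where "V = {..<24 * u + (n - c)}"
  have V: "?C \<subseteq> V" "finite V" "card (V - ?C) = n - c"
    by (auto simp: V_def card_Diff_subset)
  obtain r where r: "C.giant {} r" using C.giant_exists[of "{}"] by auto
  \<comment> \<open>Flows mention \<open>E\<close> only, so the haven of the core also serves the
    padded graph.\<close>
  interpret haven_graph V E C.giant u r
  proof unfold_locales
    show "E \<subseteq> V \<times> V" using E(1) V(1) by blast
    show "t \<notin> S" if "C.giant S t" for S t using that by (rule C.giant_nontrivial)
    show "C.giant S' t" if "C.giant S t" "S' \<subseteq> S" for S S' t
      using that by (auto intro: C.giant_antimono)
  qed (use E V r C.giant_exists C.giant_meet in auto)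
  let ?G = "cfi V E {}" and ?H = "cfi V E {r}"
  have G: "card (pverts ?G) = n"
    using card_cfi_isolated[OF C.base_graph_axioms V(1,2)] V(3) c by (simp add: c_def)
  \<comment> \<open>Equivalence for \<open>k = 1\<close> already forces equally many vertices, so
    the twisted gadget need not be counted.\<close>
  have "wl_equivalent 1 ?G ?H" using u(1) by (intro cfi_wl_equivalent) simp
  then have "card (wl_tuples 1 ?G) = card (wl_tuples 1 ?H)"
    unfolding wl_equivalent_def by (metis size_image_mset size_mset_set)
  then have H: "card (pverts ?H) = n"
    using G by (simp add: card_wl_tuples finite_cfi)
  have "wl_equivalent k ?G ?H" if k: "real k < 1 / 96 * real n - 1" for k
  proof (rule cfi_wl_equivalent)
    \<comment> \<open>The \<open>- 1\<close> in the bound on \<open>k\<close> pays for the extra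
      pebble in \<open>Suc k \<le> u\<close>.\<close>
    from k have "real (96 * Suc k) < real n" by simp
    then have "96 * Suc k < n" by (simp only: of_nat_less_iff)
    then show "Suc k \<le> u" by (simp add: u_def less_eq_div_iff_mult_less_eq)
  qed
  moreover have "r \<in> V" using C.giant_nontrivial(2)[OF r] V(1) by blast
  ultimately show "\<exists>(G :: nat pair_pre_digraph) (H :: nat pair_pre_digraph).
       pair_graph G \<and> pair_graph H \<and>
       card (pverts G) = n \<and> card (pverts H) = n \<and>
       \<not> digraph_iso (with_proj G) (with_proj H) \<and>
       (\<forall>k::nat. k \<ge> 1 \<and> real k < 1 / 96 * real n - 1 \<longrightarrow> wl_equivalent k G H)"
    using pair_graph_cfi G H cfi_not_iso by blast
qed

end
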